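(* Suppose that Assumptions 1 and 2 (stated in the context) hold and $\varkappa_U(\mathbb Z)<\infty$. If $$\varkappa_U(a)\le a\qquad\forall a\in[r,R],$$ and if $u_\epsilon=2^\epsilon(1+\epsilon)$, then for any $\epsilon\in(0,1]$, $y>0$ and $q\ge1$, with $J:=[\epsilon^{-1}\log_2(R/r)-1]_+$ (rounded up to an integer), $$\mathrm P\{\Psi^*_{u_\epsilon}(y,\mathbb Z)\ge0\}\le N_{\mathbb Z,\mathrm d}(\epsilon/8)\sum_{j=0}^{J}L^{(\epsilon)}_g\big(y,r2^{\epsilon(j+1)}\big),$$ $$\mathrm E\big[\Psi^*_{u_\epsilon}(y,\mathbb Z)\big]_+^q\le N_{\mathbb Z,\mathrm d}(\epsilon/8)\,\big[u_\epsilon C^*(y)\big]^q\sum_{j=0}^{J}\big[r2^{\epsilon(j+1)}\big]^qJ^{(\epsilon)}_g\big(y,r2^{\epsilon(j+1)}\big),$$ where $J^{(\epsilon)}_g(z,a):=q\int_1^\infty(x-1)^{q-1}L^{(\epsilon)}_g(zx,a)\,dx$.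
   Context: Setting. $\mathfrak S,\mathfrak H$ are linear topological spaces, $(\Omega,\mathfrak A,\mathrm P)$ is a complete probability space, and $\xi_\theta:\Omega\to\mathfrak S$, $\theta\in\mathfrak H$, is a family of random mappings such that $\theta\mapsto\xi_\theta(\omega)$ is linear and continuous on $\mathfrak H$ for every $\omega\in\Omega$, and $\xi_\theta(\cdot)$ is $\mathfrak A$-measurable for every $\theta\in\mathfrak H$. $\Psi:\mathfrak S\to\mathbb R_+$ is a sub-additive functional, and $\Theta\subset\mathfrak H$ is a fixed subset. Assumption 1. There are functions $A,B,U:\mathfrak H\to\mathbb R_+$ and $g:\mathbb R_+\to\mathbb R_+$ such that (i) for any $z>0$ and all $\theta\in\mathfrak H$, $\mathrm P\{\Psi(\xi_\theta)-U(\theta)\ge z\}\le g\big(\frac{z^2}{A^2(\theta)+B(\theta)z}\big)$; (ii) $g$ is monotonically decreasing to $0$; (iii) $0<r:=\inf_{\theta\in\Theta}U(\theta)\le\sup_{\theta\in\Theta}U(\theta)=:R\le\infty$. Assumption 2. $(\mathfrak Z,\mathrm d)$ is a metric space, $\mathbb Z$ is a totally bounded subset of it, and there is a continuous mapping $\phi:\mathfrak Z\to\mathfrak H$ with $\Theta=\{\theta\in\mathfrak H:\theta=\phi[\zeta],\ \zeta\in\mathbb Z\}$. Notation. For $Z\subseteq\mathbb Z$ (suprema of ratios are over $\zeta_1\neq\zeta_2$): $$\varkappa_U(Z):=\sup_{\zeta_1,\zeta_2\in Z}\frac{U(\phi[\zeta_1]-\phi[\zeta_2])}{\mathrm d(\zeta_1,\zeta_2)}\vee\sup_{\zeta\in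 Z}U(\phi[\zeta]),$$ and $\Lambda_A(Z)$, $\Lambda_B(Z)$ are defined by the same formula with $U$ replaced by $A$, respectively $B$. $N_{Z,\mathrm d}(\delta)$ is the minimal number of balls of radius $\delta$ in the metric $\mathrm d$ needed to cover $Z$. For $y>0$, $\epsilon>0$, $L^{(\epsilon)}_{g,Z}(y)=g(y)+\sum_{k=1}^\infty[N_{Z,\mathrm d}(\epsilon2^{-k})]^2g(9y\,2^{k-3}k^{-2})$. For $a\in[r,R]$ (and likewise for any $a>0$) let $\mathbb Z_a:=\{\zeta\in\mathbb Z: a/2<U(\phi[\zeta])\le a\}$ and write $\varkappa_U(a):=\varkappa_U(\mathbb Z_a)$, $L^{(\epsilon)}_g(y,a):=L^{(\epsilon)}_{g,\mathbb Z_a}(y)$. Put $$\Lambda_A:=\sup_{a\in[r,R]}a^{-1}\Lambda_A(\mathbb Z_a),\quad \Lambda_B:=\sup_{a\in[r,R]}a^{-1}\Lambda_B(\mathbb Z_a),\quad C^*(y):=1+2\sqrt y\,\Lambda_A+2y\,\Lambda_B,$$ and, for $u\ge1$, $y>0$, $Z\subseteq\mathbb Z$, $$\Psi^*_u(y,Z):=\sup_{\zeta\in Z}\big\{\Psi(\xi_{\phi[\zeta]})-u\,C^*(y)\,U(\phi[\zeta])\big\}.$$ Here $[x]_+=\max(x,0)$.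
   Formalization: The functional Ψ is additionally assumed lower semicontinuous, and when ε = 1 the infimum r of U over Θ is assumed not to be attained; without either assumption the stated bounds can fail. *)

theory Defs
  imports "HOL-Probability.Probability"
begin

(* Neither Hausdorff nor locally convex is required. *)
class linear_topological_space = real_vector + topological_ab_group_add +
  assumes tendsto_scaleR_nhds:
    "((\<lambda>p. fst p *\<^sub>R snd p) \<longlongrightarrow> c *\<^sub>R x) (nhds c \<times>\<^sub>F nhds x)"

instance real_normed_vector \<subseteq> linear_topological_space
proof
  fix c :: real and x :: 'a
  show "((\<lambda>p. fst p *\<^sub>R snd p) \<longlongrightarrow> c *\<^sub>R x) (nhds c \<times>\<^sub>F nhds x)"
    by (intro tendsto_scaleR filterlim_fst filterlim_snd)
qed

(* The balls are closed and their centres may lie outside Z. With open balls, or with centres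
   restricted to Z, the number could only be larger. *)
definition covering_number :: "'z::metric_space set \<Rightarrow> real \<Rightarrow> ennreal" where
  "covering_number Z \<delta> =
     (INF C \<in> {C. finite C \<and> Z \<subseteq> (\<Union>c\<in>C. cball c \<delta>)}. of_nat (card C))"

(* For F = U, A, B this is \<kappa>_U(Z), \<Lambda>_A(Z), \<Lambda>_B(Z). *)
definition modulus ::
    "('z::metric_space \<Rightarrow> 'h::ab_group_add) \<Rightarrow> ('h \<Rightarrow> real) \<Rightarrow> 'z set \<Rightarrow> ennreal" where
  "modulus \<phi> F Z =
     max (SUP (\<zeta>1, \<zeta>2) \<in> {(\<zeta>1, \<zeta>2). \<zeta>1 \<in> Z \<and> \<zeta>2 \<in> Z \<and> \<zeta>1 \<noteq> \<zeta>2}.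
            ennreal (F (\<phi> \<zeta>1 - \<phi> \<zeta>2) / dist \<zeta>1 \<zeta>2))
         (SUP \<zeta>\<in>Z. ennreal (F (\<phi> \<zeta>)))"

definition slice :: "('z \<Rightarrow> 'h) \<Rightarrow> ('h \<Rightarrow> real) \<Rightarrow> 'z set \<Rightarrow> real \<Rightarrow> 'z set" where
  "slice \<phi> U Z a = {\<zeta> \<in> Z. a / 2 < U (\<phi> \<zeta>) \<and> U (\<phi> \<zeta>) \<le> a}"

(* \<Lambda>_A and \<Lambda>_B without argument, for F = A, B. *)
definition sup_modulus ::
    "('z::metric_space \<Rightarrow> 'h::ab_group_add) \<Rightarrow> ('h \<Rightarrow> real) \<Rightarrow> 'z set \<Rightarrow> real \<Rightarrow> ennreal \<Rightarrow>
     ('h \<Rightarrow> real) \<Rightarrow> ennreal" where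
  "sup_modulus \<phi> U Z r R F =
     (SUP a \<in> {a. r \<le> a \<and> ennreal a \<le> R}. modulus \<phi> F (slice \<phi> U Z a) / ennreal a)"

definition C_star ::
    "('z::metric_space \<Rightarrow> 'h::ab_group_add) \<Rightarrow> ('h \<Rightarrow> real) \<Rightarrow> ('h \<Rightarrow> real) \<Rightarrow> ('h \<Rightarrow> real) \<Rightarrow>
     'z set \<Rightarrow> real \<Rightarrow> ennreal \<Rightarrow> real \<Rightarrow> ennreal" where
  "C_star \<phi> U A B Z r R y =
     1 + 2 * ennreal (sqrt y) * sup_modulus \<phi> U Z r R A + 2 * ennreal y * sup_modulus \<phi> U Z r R B"

(* The summation index is k - 1, where k = 1, 2, ... *)
definition L_series :: "(real \<Rightarrow> real) \<Rightarrow> real \<Rightarrow> 'z::metric_space set \<Rightarrow> real \<Rightarrow> ennreal" where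
  "L_series g \<epsilon> Z y =
     ennreal (g y) +
     (\<Sum>i. let k = Suc i in
        (covering_number Z (\<epsilon> * 2 powr (- real k)))\<^sup>2 *
        ennreal (g (9 * y * 2 powr (real k - 3) / (real k)\<^sup>2)))"

definition J_integral ::
    "(real \<Rightarrow> real) \<Rightarrow> real \<Rightarrow> real \<Rightarrow> 'z::metric_space set \<Rightarrow> real \<Rightarrow> ennreal" where
  "J_integral g \<epsilon> q Z z =
     ennreal q * (\<integral>\<^sup>+x\<in>{1<..}. ennreal ((x - 1) powr (q - 1)) * L_series g \<epsilon> Z (z * x) \<partial>lborel)"

(* An infinite C makes every term -\<infinity>, provided u > 0 and U is positive on the image of Z. *)
definition Psi_star ::
    "('s \<Rightarrow> real) \<Rightarrow> ('h \<Rightarrow> 'w \<Rightarrow> 's) \<Rightarrow> ('h \<Rightarrow> real) \<Rightarrow> ('z \<Rightarrow> 'h) \<Rightarrow> 'z set \<Rightarrow>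
     real \<Rightarrow> ennreal \<Rightarrow> 'w \<Rightarrow> ereal" where
  "Psi_star \<Psi> \<xi> U \<phi> Z u C \<omega> =
     (SUP \<zeta>\<in>Z. ereal (\<Psi> (\<xi> (\<phi> \<zeta>) \<omega>)) - enn2ereal (ennreal u * C * ennreal (U (\<phi> \<zeta>))))"

(* Meaningful for R < \<infinity> only; this follows from modulus \<phi> U Z < \<infinity>, which bounds
   U on the image of Z. *)
definition last_slice :: "real \<Rightarrow> ennreal \<Rightarrow> real \<Rightarrow> nat" where
  "last_slice r R \<epsilon> = nat \<lceil>max 0 (log 2 (enn2real R / r) / \<epsilon> - 1)\<rceil>"

definition ennreal_powr :: "ennreal \<Rightarrow> real \<Rightarrow> ennreal" where
  "ennreal_powr x q = (if x = \<top> then \<top> else ennreal (enn2real x powr q))"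

(* g at the ratio s / t, with the limit value 0 of g at infinity when t = 0 (and s > 0). *)
definition g_ratio :: "(real \<Rightarrow> real) \<Rightarrow> real \<Rightarrow> real \<Rightarrow> real" where
  "g_ratio g s t = (if t = 0 then 0 else g (s / t))"

end

(* Chaining, with the slack 1 + \<epsilon> paying for the increments.

   Cut Z into the pieces T where a / 2^\<epsilon> \<le> U \<le> a, with a = r 2^(\<epsilon>(j+1)), intersected with balls of
   radius \<epsilon>/8. On such a piece U \<le> a and U(increment) \<le> a d, and likewise for A and B with a \<Lambda>_A and
   a \<Lambda>_B, so the tail assumption bounds \<Psi> of a single point by a (1 + sqrt y \<Lambda>_A + y \<Lambda>_B) up to
   probability g(y), and \<Psi> of an increment in the same way, scaled by d. Points of T are reached along
   nets taken from T itself, with mesh 2 \<epsilon> 2^(-k) (the covering balls may be centred outside T). The chain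
   starts at level k = 4, which is reached from a fixed point in one step of length at most \<epsilon>/4: starting
   at k = 1, the steps would add up to more than \<epsilon>. The nets do not depend on y, so one measurable majorant
   of \<Psi> on T satisfies all the tail bounds at once; the moment bound follows by integrating them, using
   C*(x y) \<le> x C*(y) for x \<ge> 1. *)

theory Submission
  imports Defs
begin

section \<open>Covering numbers and nets\<close>

lemma covering_number_attained:
  assumes "totally_bounded S" "0 < \<delta>"
  obtains C where "finite C" "S \<subseteq> (\<Union>c\<in>C. cball c \<delta>)" "covering_number S \<delta> = of_nat (card C)"
proof -
  let ?F = "{C. finite C \<and> S \<subseteq> (\<Union>c\<in>C. cball c \<delta>)}"
  obtain C0 where C0: "finite C0" "S \<subseteq> (\<Union>c\<in>C0. {\<zeta>. dist c \<zeta> < \<delta>})"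
    using assms unfolding totally_bounded_metric by meson
  have "(\<Union>c\<in>C0. {\<zeta>. dist c \<zeta> < \<delta>}) \<subseteq> (\<Union>c\<in>C0. cball c \<delta>)"
    by (intro UN_mono) auto
  with C0 have "C0 \<in> ?F" by blast
  then obtain C where C: "C \<in> ?F" "\<And>D. D \<in> ?F \<Longrightarrow> card C \<le> card D"
    using ex_has_least_nat[of "\<lambda>D. D \<in> ?F" C0 card] by auto
  have "covering_number S \<delta> = of_nat (card C)"
    unfolding covering_number_def
    by (rule antisym[OF INF_lower[OF C(1)] INF_greatest]) (use C(2) in simp)
  with C(1) that show thesis by blast
qed

lemma covering_number_antimono:
  assumes "\<delta> \<le> \<delta>'"
  shows "covering_number S \<delta>' \<le> covering_number S \<delta>"
proof -
  have "(\<Union>c\<in>C. cball c \<delta>) \<subseteq> (\<Union>c\<in>C. cball c \<delta>')" for C :: "'a set"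
    using assms by (intro UN_mono) auto
  then show ?thesis
    unfolding covering_number_def by (intro INF_superset_mono) blast+
qed

text \<open>The net has to lie in \<open>T\<close>, because the tails used in chaining are
  controlled only there. For each ball that serves a point of \<open>T\<close>, one such point is
  kept as representative. A point and its representative share a ball, hence the distance
  \<open>2 * \<delta>\<close>, and there are at most as many representatives as balls.\<close>

lemma covering_net:
  assumes "totally_bounded S" "0 < \<delta>" "T \<subseteq> S"
  obtains \<pi> where "\<pi> ` T \<subseteq> T" "\<And>\<zeta>. \<zeta> \<in> T \<Longrightarrow> dist \<zeta> (\<pi> \<zeta>) \<le> 2 * \<delta>" "finite (\<pi> ` T)"
    "of_nat (card (\<pi> ` T)) \<le> covering_number S \<delta>"
proof -
  obtain C where C: "finite C" "S \<subseteq> (\<Union>c\<in>C. cball c \<delta>)" "covering_number S \<delta> = of_nat (card C)"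
    using covering_number_attained[OF assms(1,2)] .
  have "\<forall>\<zeta>\<in>T. \<exists>c\<in>C. dist c \<zeta> \<le> \<delta>"
    using C(2) assms(3) by (auto simp: subset_iff)
  then obtain f where f: "\<And>\<zeta>. \<zeta> \<in> T \<Longrightarrow> f \<zeta> \<in> C \<and> dist (f \<zeta>) \<zeta> \<le> \<delta>" by metis
  define \<pi> where "\<pi> \<zeta> = inv_into T f (f \<zeta>)" for \<zeta>
  have inT: "\<pi> \<zeta> \<in> T" and feq: "f (\<pi> \<zeta>) = f \<zeta>" if "\<zeta> \<in> T" for \<zeta>
    using that by (auto simp: \<pi>_def inv_into_into f_inv_into_f)
  have fT: "finite (f ` T)" "card (f ` T) \<le> card C"
    using f C(1) by (auto intro!: card_mono intro: finite_subset)
  have eq: "\<pi> ` T = inv_into T f ` f ` T" by (auto simp: \<pi>_def)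
  show thesis
  proof
    show "\<pi> ` T \<subseteq> T" using inT by auto
    show "dist \<zeta> (\<pi> \<zeta>) \<le> 2 * \<delta>" if "\<zeta> \<in> T" for \<zeta>
      using f[OF that] f[OF inT[OF that]] feq[OF that] dist_triangle3[of \<zeta> "\<pi> \<zeta>" "f \<zeta>"] by simp
    show "finite (\<pi> ` T)" using fT eq by simp
    have "card (\<pi> ` T) \<le> card C"
      unfolding eq using card_image_le[OF fT(1), of "inv_into T f"] fT(2) by simp
    then show "of_nat (card (\<pi> ` T)) \<le> covering_number S \<delta>" using C(3) by simp
  qed
qed

section \<open>Moduli and the tail at a single parameter\<close>

lemma modulus_mono: "S \<subseteq> T \<Longrightarrow> modulus \<phi> F S \<le> modulus \<phi> F T"
  unfolding modulus_def by (intro max.mono SUP_subset_mono) auto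

lemma modulus_le_imp_value_le:
  assumes "modulus \<phi> F S \<le> ennreal b" "0 \<le> b" "\<zeta> \<in> S"
  shows "F (\<phi> \<zeta>) \<le> b"
proof -
  have "ennreal (F (\<phi> \<zeta>)) \<le> (SUP \<zeta>\<in>S. ennreal (F (\<phi> \<zeta>)))"
    using assms(3) by (rule SUP_upper)
  also have "\<dots> \<le> ennreal b" using assms(1) unfolding modulus_def by simp
  finally show ?thesis using assms(2) by (simp add: ennreal_le_iff)
qed

text \<open>The supremum of ratios skips the diagonal and so gives no bound on \<open>F 0\<close>:
  the points must differ. Chaining therefore treats coinciding neighbours separately.\<close>

lemma modulus_le_imp_increment_le:
  assumes "modulus \<phi> F S \<le> ennreal b" "0 \<le> b" "\<zeta>1 \<in> S" "\<zeta>2 \<in> S" "\<zeta>1 \<noteq> \<zeta>2"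
  shows "F (\<phi> \<zeta>1 - \<phi> \<zeta>2) \<le> b * dist \<zeta>1 \<zeta>2"
proof -
  have "ennreal (F (\<phi> \<zeta>1 - \<phi> \<zeta>2) / dist \<zeta>1 \<zeta>2) \<le>
      (SUP (\<zeta>1, \<zeta>2) \<in> {(\<zeta>1, \<zeta>2). \<zeta>1 \<in> S \<and> \<zeta>2 \<in> S \<and> \<zeta>1 \<noteq> \<zeta>2}.
            ennreal (F (\<phi> \<zeta>1 - \<phi> \<zeta>2) / dist \<zeta>1 \<zeta>2))"
    using assms(3-5) by (intro SUP_upper2[of "(\<zeta>1,\<zeta>2)"]) auto
  also have "\<dots> \<le> ennreal b" using assms(1) unfolding modulus_def by simp
  finally show ?thesis using assms(2,5) by (simp add: ennreal_le_iff field_simps)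
qed

(* The event is strict because the assumed bound says nothing about z = 0, the threshold when \<alpha> = \<beta> = 0. *)
lemma (in prob_space) bernstein_tail:
  assumes [measurable]: "Y \<in> borel_measurable M"
    and tail: "\<And>z. 0 < z \<Longrightarrow> \<P>(\<omega> in M. Y \<omega> - v \<ge> z) \<le> g_ratio g (z\<^sup>2) (\<alpha>\<^sup>2 + \<beta> * z)"
    and ab: "0 \<le> \<alpha>" "0 \<le> \<beta>" and s: "0 < s"
    and g: "\<And>x. 0 \<le> x \<Longrightarrow> 0 \<le> g x" "antimono_on {0..} g"
  shows "\<P>(\<omega> in M. Y \<omega> > v + sqrt s * \<alpha> + s * \<beta>) \<le> g s"
proof (cases "0 < sqrt s * \<alpha> + s * \<beta>")
  case True
  define z where "z = sqrt s * \<alpha> + s * \<beta>"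
  have z: "0 < z" using True by (simp add: z_def)
  have "\<P>(\<omega> in M. Y \<omega> > v + sqrt s * \<alpha> + s * \<beta>) \<le> \<P>(\<omega> in M. Y \<omega> - v \<ge> z)"
    by (rule finite_measure_mono) (auto simp: z_def)
  also have "\<dots> \<le> g_ratio g (z\<^sup>2) (\<alpha>\<^sup>2 + \<beta> * z)" by (rule tail[OF z])
  also have "\<dots> \<le> g s"
  proof (cases "\<alpha>\<^sup>2 + \<beta> * z = 0")
    case True
    then show ?thesis using g(1) s by (simp add: g_ratio_def)
  next
    case False
    then have pos: "0 < \<alpha>\<^sup>2 + \<beta> * z" using ab z by (simp add: less_le)
    \<comment> \<open>Since \<open>z\<close> is the sum of \<open>s * \<beta>\<close> and
      \<open>sqrt s * \<alpha>\<close>, and the latter is at most \<open>z\<close>, the square of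
      \<open>z\<close> is at least \<open>s\<close> times the denominator. The argument of the
      decreasing \<open>g\<close> is then at least \<open>s\<close>.\<close>
    have "s * (\<alpha>\<^sup>2 + \<beta> * z) = s * \<beta> * z + (sqrt s * \<alpha>) * (sqrt s * \<alpha>)"
      using real_sqrt_pow2[of s] s by (simp add: algebra_simps power2_eq_square)
    also have "\<dots> \<le> s * \<beta> * z + (sqrt s * \<alpha>) * z"
      using s ab by (intro add_left_mono mult_left_mono) (auto simp: z_def)
    also have "\<dots> = z\<^sup>2" by (simp add: z_def algebra_simps power2_eq_square)
    finally have "s \<le> z\<^sup>2 / (\<alpha>\<^sup>2 + \<beta> * z)" using pos by (simp add: field_simps)
    then show ?thesis using False s g(2) by (auto simp: g_ratio_def monotone_on_def)
  qed
  finally show ?thesis .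
next
  case False
  have "0 \<le> sqrt s * \<alpha>" "0 \<le> s * \<beta>" using ab s by auto
  with False have z0: "sqrt s * \<alpha> = 0" "s * \<beta> = 0" by linarith+
  then have ab0: "\<alpha> = 0" "\<beta> = 0" using s by auto
  \<comment> \<open>With \<alpha> = \<beta> = 0 the denominator vanishes and \<open>g_ratio\<close>
    takes its default 0. Every positive excess over \<open>v\<close> is thus null, and the excesses
    \<open>1 / Suc n\<close> exhaust the strict event.\<close>
  have null: "{\<omega> \<in> space M. Y \<omega> - v \<ge> 1 / Suc n} \<in> null_sets M" for n :: nat
  proof -
    have "\<P>(\<omega> in M. Y \<omega> - v \<ge> 1 / Suc n) \<le> 0"
      using tail[of "1 / Suc n"] ab0 by (simp add: g_ratio_def)
    then show ?thesis
      by (intro null_setsI) (auto simp: emeasure_eq_measure measure_le_0_iff)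
  qed
  have "{\<omega> \<in> space M. Y \<omega> > v} \<subseteq> (\<Union>n. {\<omega> \<in> space M. Y \<omega> - v \<ge> 1 / Suc n})"
  proof
    fix \<omega> assume "\<omega> \<in> {\<omega> \<in> space M. Y \<omega> > v}"
    moreover from this obtain n where "inverse (real (Suc n)) < Y \<omega> - v"
      using reals_Archimedean[of "Y \<omega> - v"] by auto
    ultimately show "\<omega> \<in> (\<Union>n. {\<omega> \<in> space M. Y \<omega> - v \<ge> 1 / Suc n})"
      by (auto simp: inverse_eq_divide intro!: exI[of _ n])
  qed
  moreover have "(\<Union>n. {\<omega> \<in> space M. Y \<omega> - v \<ge> 1 / Suc n}) \<in> null_sets M"
    using null by (intro null_sets_UN) auto
  ultimately have "{\<omega> \<in> space M. Y \<omega> > v} \<in> null_sets M"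
    by (rule null_sets_subset[where B = "\<Union>n. {\<omega> \<in> space M. Y \<omega> - v \<ge> 1 / Suc n}", rotated 2]) simp_all
  then have "measure M {\<omega> \<in> space M. Y \<omega> > v} = 0" by (rule measure_eq_0_null_sets)
  then show ?thesis using ab0 s g(1)[of s] by simp
qed

(* Here n counts from the first level k = n + 4; the weight is 9 2^(k-3) / k^2, as in L_series. *)
definition chain_step :: "real \<Rightarrow> nat \<Rightarrow> real" where
  "chain_step \<epsilon> n = (if n = 0 then \<epsilon> / 4 else 6 * \<epsilon> / 2 ^ (n + 4))"

definition chain_weight :: "nat \<Rightarrow> real" where
  "chain_weight n = 9 * 2 ^ (n + 1) / (real n + 4)\<^sup>2"

section \<open>Sums along the chain\<close>

lemma chain_step_nonneg: "0 \<le> \<epsilon> \<Longrightarrow> 0 \<le> chain_step \<epsilon> n"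
  by (simp add: chain_step_def)

lemma chain_weight_pos: "0 < chain_weight n"
  by (auto simp: chain_weight_def)

text \<open>The first step \<epsilon>/4 is followed by a geometric series of total 3/8 \<epsilon>.
  That the limit 5/8 is below 1 yields the strict inequality at the end of the chaining
  argument.\<close>

lemma sum_chain_step: "(\<Sum>m\<le>n. chain_step \<epsilon> m) = \<epsilon> * (5 / 8 - 6 / 2 ^ (n + 4))"
  by (induction n) (auto simp: chain_step_def power_add field_simps)

text \<open>The first product is 9/32 \<epsilon>. In the later ones the powers of 2 cancel, leaving
  27/4 \<epsilon> / k^2 with k = n + 4, which telescopes through 1/k^2 \<le> 1/(k-1) - 1/k. The
  total stays below 63/32 \<epsilon>, hence below 2 \<epsilon>.\<close>

lemma sum_chain_step_weight:
  assumes "0 \<le> \<epsilon>"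
  shows "(\<Sum>m\<le>n. chain_step \<epsilon> m * chain_weight m)
          \<le> \<epsilon> * (9 / 32 + 27 / 4 * (1 / 4 - 1 / (real n + 4)))"
proof (induction n)
  case 0
  show ?case by (simp add: chain_step_def chain_weight_def)
next
  case (Suc n)
  have eq: "chain_step \<epsilon> (Suc n) * chain_weight (Suc n) = \<epsilon> * (27 / 4) * (1 / (real n + 5)\<^sup>2)"
    by (simp add: chain_step_def chain_weight_def power_add add_ac)
  have eq5: "real (Suc n) + 4 = real n + 5" by simp
  have "1 / (real n + 5)\<^sup>2 \<le> 1 / ((real n + 4) * (real n + 5))"
    by (intro divide_left_mono) (auto simp: power2_eq_square)
  also have "\<dots> = 1 / (real n + 4) - 1 / (real n + 5)" by (simp add: field_simps)
  finally have "chain_step \<epsilon> (Suc n) * chain_weight (Suc n)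
      \<le> \<epsilon> * (27 / 4) * (1 / (real n + 4) - 1 / (real n + 5))"
    unfolding eq using assms by (intro mult_left_mono) auto
  moreover have "\<epsilon> * (9 / 32 + 27 / 4 * (1 / 4 - p)) + \<epsilon> * (27 / 4) * (p - q)
      = \<epsilon> * (9 / 32 + 27 / 4 * (1 / 4 - q))" for p q :: real
    by (simp add: field_simps)
  ultimately show ?case using Suc by (metis (no_types, lifting) add_mono sum.atMost_Suc eq5)
qed

text \<open>Total price of the increments when level m is given the tail parameter
  \<open>y * chain_weight m\<close>. The coefficients 2 are affordable because 1 + 2 \<epsilon>
  \<le> 2 (1 + \<epsilon>), which is what the factors 2 in \<open>C_star\<close> pay for.\<close>

lemma chain_sum_le:
  assumes "0 \<le> \<epsilon>" "0 \<le> \<alpha>" "0 \<le> \<beta>" "0 \<le> y"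
  shows "(\<Sum>m<n. chain_step \<epsilon> m *
            (1 + sqrt (y * chain_weight m) * \<alpha> + y * chain_weight m * \<beta>))
          \<le> \<epsilon> * (5 / 8 + 2 * (sqrt y * \<alpha>) + 2 * (y * \<beta>))"
proof -
  have sub: "{..<n} \<subseteq> {..n}" by auto
  have d: "(\<Sum>m<n. chain_step \<epsilon> m) \<le> 5 / 8 * \<epsilon>"
  proof -
    have "(\<Sum>m<n. chain_step \<epsilon> m) \<le> (\<Sum>m\<le>n. chain_step \<epsilon> m)"
      using assms(1) by (intro sum_mono2) (auto simp: chain_step_nonneg)
    also have "\<dots> \<le> \<epsilon> * (5 / 8)"
      unfolding sum_chain_step using assms(1) by (intro mult_left_mono) auto
    finally show ?thesis by simp
  qed
  have w: "(\<Sum>m<n. chain_step \<epsilon> m * chain_weight m) \<le> 2 * \<epsilon>"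
  proof -
    have "(\<Sum>m<n. chain_step \<epsilon> m * chain_weight m) \<le> (\<Sum>m\<le>n. chain_step \<epsilon> m * chain_weight m)"
      using assms(1)
      by (intro sum_mono2) (auto simp: chain_step_nonneg chain_weight_pos less_imp_le)
    also note sum_chain_step_weight[OF assms(1)]
    also have "\<epsilon> * (9 / 32 + 27 / 4 * (1 / 4 - 1 / (real n + 4))) \<le> \<epsilon> * 2"
      using assms(1) by (intro mult_left_mono) (auto simp: field_simps)
    finally show ?thesis by simp
  qed
  \<comment> \<open>The arithmetic-geometric mean inequality reduces the sum with square roots to
    the two sums already bounded.\<close>
  have sqrt_w: "sqrt (chain_weight m) \<le> (1 + chain_weight m) / 2" for m
    using arith_geo_mean_sqrt[of 1 "chain_weight m"] chain_weight_pos[of m] by simp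
  have s: "(\<Sum>m<n. chain_step \<epsilon> m * sqrt (chain_weight m)) \<le> 2 * \<epsilon>"
  proof -
    have "(\<Sum>m<n. chain_step \<epsilon> m * sqrt (chain_weight m))
        \<le> (\<Sum>m<n. chain_step \<epsilon> m * ((1 + chain_weight m) / 2))"
      using assms(1) sqrt_w by (intro sum_mono mult_left_mono) (auto simp: chain_step_nonneg)
    also have "\<dots> = ((\<Sum>m<n. chain_step \<epsilon> m) + (\<Sum>m<n. chain_step \<epsilon> m * chain_weight m)) / 2"
      by (simp add: sum.distrib[symmetric] sum_divide_distrib algebra_simps add_divide_distrib)
    also have "\<dots> \<le> 2 * \<epsilon>" using d w assms(1) by simp
    finally show ?thesis .
  qed
  have "(\<Sum>m<n. chain_step \<epsilon> m * (1 + sqrt (y * chain_weight m) * \<alpha> + y * chain_weight m * \<beta>))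
     = (\<Sum>m<n. chain_step \<epsilon> m) + (\<Sum>m<n. chain_step \<epsilon> m * sqrt (chain_weight m)) * (sqrt y * \<alpha>)
       + (\<Sum>m<n. chain_step \<epsilon> m * chain_weight m) * (y * \<beta>)"
    by (simp add: sum.distrib sum_distrib_left algebra_simps real_sqrt_mult)
  also have "\<dots> \<le> 5 / 8 * \<epsilon> + 2 * \<epsilon> * (sqrt y * \<alpha>) + 2 * \<epsilon> * (y * \<beta>)"
    using d w s assms by (intro add_mono mult_right_mono) auto
  finally show ?thesis by (simp add: algebra_simps)
qed

text \<open>Level k = n + 4 sits at index n + 3 of the series; the terms for k = 1, 2, 3 are
  nonnegative and are dropped, as the chain starts at k = 4.\<close>

lemma L_series_ge:
  "ennreal (g y) + (\<Sum>n. (covering_number S (\<epsilon> / 2 ^ (n + 4)))\<^sup>2 * ennreal (g (y * chain_weight n)))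
    \<le> L_series g \<epsilon> S y"
proof -
  define f where "f i = (let k = Suc i in (covering_number S (\<epsilon> * 2 powr (- real k)))\<^sup>2 *
        ennreal (g (9 * y * 2 powr (real k - 3) / (real k)\<^sup>2)))" for i
  have "(covering_number S (\<epsilon> / 2 ^ (n + 4)))\<^sup>2 * ennreal (g (y * chain_weight n)) = f (n + 3)" for n
  proof -
    have "\<epsilon> * 2 powr (- real (n + 4)) = \<epsilon> / 2 ^ (n + 4)"
      unfolding powr_minus powr_realpow[OF zero_less_numeral] by (simp add: field_simps)
    moreover have "2 powr (real (n + 4) - 3) = (2::real) ^ (n + 1)"
      using powr_realpow[of 2 "n + 1"] by (simp add: algebra_simps)
    then have "9 * y * 2 powr (real (n + 4) - 3) / (real (n + 4))\<^sup>2 = y * chain_weight n"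
      by (simp add: chain_weight_def)
    moreover have "Suc (n + 3) = n + 4" by simp
    ultimately show ?thesis unfolding f_def Let_def by metis
  qed
  moreover have "(\<Sum>n. f (n + 3)) \<le> (\<Sum>i. f i)"
    using suminf_offset[of f 3] by (simp add: add_increasing)
  ultimately show ?thesis
    unfolding L_series_def f_def by (simp add: add_left_mono)
qed

section \<open>Chaining on one piece\<close>

text \<open>\<open>X\<close> stands for \<Psi> at a parameter and \<open>D\<close> for \<Psi> of an
  increment. \<open>X_D\<close> is sub-additivity; \<open>X_lsc\<close> carries bounds from the nets
  to all of \<open>T\<close>. One \<open>Y\<close> serves every \<open>y\<close>, as the later
  integration over levels requires.\<close>

lemma (in prob_space) chaining:
  fixes X :: "'z::metric_space \<Rightarrow> 'a \<Rightarrow> real" and D :: "'z \<Rightarrow> 'z \<Rightarrow> 'a \<Rightarrow> real"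
  assumes X[measurable]: "\<And>\<zeta>. X \<zeta> \<in> borel_measurable M"
    and D[measurable]: "\<And>\<zeta> \<zeta>'. D \<zeta> \<zeta>' \<in> borel_measurable M"
    and X_nonneg: "\<And>\<zeta> \<omega>. 0 \<le> X \<zeta> \<omega>"
    and X_D: "\<And>\<zeta> \<zeta>' \<omega>. \<omega> \<in> space M \<Longrightarrow> X \<zeta> \<omega> \<le> X \<zeta>' \<omega> + D \<zeta> \<zeta>' \<omega>"
    and X_lsc: "\<And>\<omega> x \<zeta> c. \<omega> \<in> space M \<Longrightarrow> x \<longlonglongrightarrow> \<zeta> \<Longrightarrow> (\<And>n::nat. X (x n) \<omega> \<le> c) \<Longrightarrow> X \<zeta> \<omega> \<le> c"
    and X_tail: "\<And>\<zeta> s. \<zeta> \<in> T \<Longrightarrow> 0 < s \<Longrightarrow>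
          \<P>(\<omega> in M. X \<zeta> \<omega> > b * (1 + sqrt s * \<alpha> + s * \<beta>)) \<le> g s"
    and D_tail: "\<And>\<zeta> \<zeta>' s. \<zeta> \<in> T \<Longrightarrow> \<zeta>' \<in> T \<Longrightarrow> \<zeta> \<noteq> \<zeta>' \<Longrightarrow> 0 < s \<Longrightarrow>
          \<P>(\<omega> in M. D \<zeta> \<zeta>' \<omega> > dist \<zeta> \<zeta>' * (b * (1 + sqrt s * \<alpha> + s * \<beta>))) \<le> g s"
    and S: "totally_bounded S" "T \<subseteq> S" and T: "T \<subseteq> cball c (\<epsilon> / 8)"
    and pos: "0 < \<epsilon>" "0 < b" "0 \<le> \<alpha>" "0 \<le> \<beta>"
  obtains Y :: "'a \<Rightarrow> ennreal" where "Y \<in> borel_measurable M"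
    "\<And>\<zeta> \<omega>. \<zeta> \<in> T \<Longrightarrow> \<omega> \<in> space M \<Longrightarrow> ennreal (X \<zeta> \<omega>) \<le> Y \<omega>"
    "\<And>y. 0 < y \<Longrightarrow>
      emeasure M {\<omega> \<in> space M. ennreal ((1 + \<epsilon>) * (b * (1 + 2 * sqrt y * \<alpha> + 2 * y * \<beta>))) \<le> Y \<omega>}
        \<le> L_series g \<epsilon> S y"
proof (cases "T = {}")
  case True
  \<comment> \<open>There is no starting point here, but \<open>Y = 0\<close> will do: the threshold
    is positive, so the event is empty.\<close>
  have "{\<omega> \<in> space M. ennreal ((1 + \<epsilon>) * (b * (1 + 2 * sqrt y * \<alpha> + 2 * y * \<beta>))) \<le> (0::ennreal)} = {}"
    if "0 < y" for y
  proof -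
    have "0 < (1 + \<epsilon>) * (b * (1 + 2 * sqrt y * \<alpha> + 2 * y * \<beta>))"
      using pos that by (intro mult_pos_pos add_pos_nonneg) auto
    then show ?thesis by (simp add: ennreal_eq_0_iff)
  qed
  note empty = this
  show thesis
  proof (rule that[of "\<lambda>_. 0"])
    show "emeasure M {\<omega> \<in> space M. ennreal ((1 + \<epsilon>) * (b * (1 + 2 * sqrt y * \<alpha> + 2 * y * \<beta>))) \<le> 0}
        \<le> L_series g \<epsilon> S y" if "0 < y" for y
      unfolding empty[OF that] by simp
  qed (use True in auto)
next
  case False
  then obtain \<zeta>0 where \<zeta>0: "\<zeta>0 \<in> T" by blast
  define \<delta> where "\<delta> n = \<epsilon> / 2 ^ (n + 4)" for n :: nat
  have \<delta>: "0 < \<delta> n" for n using pos by (simp add: \<delta>_def)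
  have "\<exists>\<pi>. \<pi> ` T \<subseteq> T \<and> (\<forall>\<zeta>\<in>T. dist \<zeta> (\<pi> \<zeta>) \<le> 2 * \<delta> n) \<and> finite (\<pi> ` T) \<and>
      of_nat (card (\<pi> ` T)) \<le> covering_number S (\<delta> n)" for n
    using covering_net[OF S(1) \<delta> S(2)] by metis
  then obtain \<pi> where \<pi>: "\<And>n. \<pi> n ` T \<subseteq> T" "\<And>n \<zeta>. \<zeta> \<in> T \<Longrightarrow> dist \<zeta> (\<pi> n \<zeta>) \<le> 2 * \<delta> n"
      "\<And>n. finite (\<pi> n ` T)" "\<And>n. of_nat (card (\<pi> n ` T)) \<le> covering_number S (\<delta> n)"
    by metis
  \<comment> \<open>The shift by one puts the fixed starting point at index 0;
    \<open>p (Suc m)\<close> is the net of covering radius \<open>\<delta> m\<close>.\<close>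
  define p where "p n = (case n of 0 \<Rightarrow> (\<lambda>_. \<zeta>0) | Suc m \<Rightarrow> \<pi> m)" for n
  have pT: "p n \<zeta> \<in> T" if "\<zeta> \<in> T" for n \<zeta>
    using \<pi>(1) \<zeta>0 that by (cases n) (auto simp: p_def)
  have fin: "finite (p n ` T)" for n
    using \<pi>(3) False by (cases n) (auto simp: p_def image_constant_conv)
  have p_dist: "dist (p n \<zeta>) (p (Suc n) \<zeta>) \<le> chain_step \<epsilon> n" if "\<zeta> \<in> T" for n \<zeta>
  proof (cases n)
    case 0
    have "\<pi> 0 \<zeta> \<in> T" using \<pi>(1) that by blast
    with T \<zeta>0 have "dist c \<zeta>0 \<le> \<epsilon> / 8" "dist c (\<pi> 0 \<zeta>) \<le> \<epsilon> / 8"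
      by (auto simp: subset_iff)
    then show ?thesis
      using 0 dist_triangle3[of \<zeta>0 "\<pi> 0 \<zeta>" c] by (simp add: p_def chain_step_def)
  next
    case (Suc m)
    \<comment> \<open>The detour through \<zeta> explains the 6 in \<open>chain_step\<close>: in
      units of \<epsilon> / 2^(n+4) the two legs measure 4 and 2.\<close>
    have "dist (\<pi> m \<zeta>) (\<pi> (Suc m) \<zeta>) \<le> 2 * \<delta> m + 2 * \<delta> (Suc m)"
      using \<pi>(2)[OF that, of m] \<pi>(2)[OF that, of "Suc m"] dist_triangle3[of "\<pi> m \<zeta>" "\<pi> (Suc m) \<zeta>" \<zeta>]
      by simp
    also have "\<dots> = chain_step \<epsilon> n"
      using Suc by (simp add: chain_step_def \<delta>_def power_add field_simps)
    finally show ?thesis using Suc by (simp add: p_def)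
  qed
  \<comment> \<open>The square arises because both ends of link n are counted at the radius of the
    finer net; the other end lies in a coarser net or is the starting point.\<close>
  have card_le: "of_nat (card (p n ` T) * card (p (Suc n) ` T)) \<le> (covering_number S (\<delta> n))\<^sup>2" for n
  proof -
    have "of_nat (card (p n ` T)) \<le> covering_number S (\<delta> n)"
    proof (cases n)
      case 0
      have "1 \<le> card (\<pi> 0 ` T)" using \<pi>(3)[of 0] False by (simp add: Suc_le_eq card_gt_0_iff)
      then have "of_nat 1 \<le> (of_nat (card (\<pi> 0 ` T)) :: ennreal)" by (rule of_nat_mono)
      also note \<pi>(4)
      finally show ?thesis using 0 False by (simp add: p_def image_constant_conv)
    next
      case (Suc m)
      have "covering_number S (\<delta> m) \<le> covering_number S (\<delta> n)"
        using pos Suc by (intro covering_number_antimono) (auto simp: \<delta>_def field_simps)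
      with \<pi>(4)[of m] Suc show ?thesis by (simp add: p_def)
    qed
    moreover have "of_nat (card (p (Suc n) ` T)) \<le> covering_number S (\<delta> n)"
      using \<pi>(4) by (simp add: p_def)
    ultimately show ?thesis by (simp add: power2_eq_square mult_mono)
  qed
  \<comment> \<open>Countably many finite nets keep the supremum measurable, and \<open>y\<close>
    does not enter.\<close>
  define Y where "Y \<omega> = (SUP n. SUP \<zeta>\<in>p (Suc n) ` T. ennreal (X \<zeta> \<omega>))" for \<omega>
  have Y_meas: "Y \<in> borel_measurable M"
    unfolding Y_def using fin by (intro borel_measurable_SUP) (auto intro: countable_finite)
  have Y_ge: "ennreal (X (p (Suc n) \<zeta>) \<omega>) \<le> Y \<omega>" if "\<zeta> \<in> T" for n \<zeta> \<omega>
    unfolding Y_def using that by (intro SUP_upper2[of n] SUP_upper) auto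
  have X_le_Y: "ennreal (X \<zeta> \<omega>) \<le> Y \<omega>" if "\<zeta> \<in> T" "\<omega> \<in> space M" for \<zeta> \<omega>
  proof (cases "Y \<omega>")
    case (real t)
    \<comment> \<open>When \<open>Y \<omega>\<close> is a finite \<open>t\<close>, the net points
      converge to \<zeta> with \<open>X\<close> at most \<open>t\<close> along them, so
      \<open>X_lsc\<close> applies.\<close>
    have "(\<lambda>n. \<pi> n \<zeta>) \<longlonglongrightarrow> \<zeta>"
    proof (rule tendsto_dist_iff[THEN iffD2])
      have "(\<lambda>n. \<epsilon> / 8 * (1 / 2) ^ n) \<longlonglongrightarrow> \<epsilon> / 8 * 0"
        by (intro tendsto_mult LIMSEQ_realpow_zero) auto
      then have lim: "(\<lambda>n. 2 * \<delta> n) \<longlonglongrightarrow> 0"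
        by (simp add: \<delta>_def power_add power_divide)
      show "(\<lambda>n. dist (\<pi> n \<zeta>) \<zeta>) \<longlonglongrightarrow> 0"
        by (rule tendsto_sandwich[OF _ _ tendsto_const lim])
           (use \<pi>(2)[OF that(1)] in \<open>auto simp: dist_commute\<close>)
    qed
    moreover have "X (\<pi> n \<zeta>) \<omega> \<le> t" for n
      using Y_ge[OF that(1), of n \<omega>] real by (simp add: p_def)
    ultimately have "X \<zeta> \<omega> \<le> t" by (rule X_lsc[OF that(2)])
    then show ?thesis using real by (simp add: ennreal_leI)
  qed simp
  have tail: "emeasure M {\<omega> \<in> space M. ennreal ((1 + \<epsilon>) * (b * (1 + 2 * sqrt y * \<alpha> + 2 * y * \<beta>))) \<le> Y \<omega>}
        \<le> L_series g \<epsilon> S y" if y: "0 < y" for y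
  proof -
    define h where "h s = 1 + sqrt s * \<alpha> + s * \<beta>" for s
    \<comment> \<open>The tail parameter of level n, chosen so that \<open>g (w n)\<close> is the
      corresponding value of \<open>g\<close> in \<open>L_series\<close>.\<close>
    define w where "w n = y * chain_weight n" for n
    have w: "0 < w n" for n using y chain_weight_pos by (simp add: w_def)
    have h: "0 \<le> h s" if "0 \<le> s" for s using that pos by (simp add: h_def)
    \<comment> \<open>Only links that the chain can use: distinct, as \<open>D_tail\<close> demands,
      and short, so that \<open>chain_step\<close> may replace the distance in the
      threshold.\<close>
    define P where "P n = {(\<zeta>, \<zeta>') \<in> p n ` T \<times> p (Suc n) ` T. \<zeta> \<noteq> \<zeta>' \<and> dist \<zeta> \<zeta>' \<le> chain_step \<epsilon> n}" for n
    define E where "E n \<zeta> \<zeta>' = {\<omega> \<in> space M. D \<zeta>' \<zeta> \<omega> > chain_step \<epsilon> n * (b * h (w n))}" for n \<zeta> \<zeta>'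
    define bad where "bad n = (\<Union>(\<zeta>, \<zeta>')\<in>P n. E n \<zeta> \<zeta>')" for n
    define bad0 where "bad0 = {\<omega> \<in> space M. X \<zeta>0 \<omega> > b * h y}"
    have finP: "finite (P n)" for n
      unfolding P_def using fin by (auto intro: finite_subset[OF _ finite_cartesian_product[OF fin fin]])
    have E_meas[measurable]: "E n \<zeta> \<zeta>' \<in> sets M" for n \<zeta> \<zeta>' unfolding E_def by measurable
    have bad_meas[measurable]: "bad n \<in> sets M" for n
      unfolding bad_def using finP by (auto intro!: sets.finite_UN)
    have bad0_meas[measurable]: "bad0 \<in> sets M" unfolding bad0_def by measurable
    have E_le: "emeasure M (E n \<zeta> \<zeta>') \<le> ennreal (g (w n))" if "(\<zeta>, \<zeta>') \<in> P n" for n \<zeta> \<zeta>'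
    proof -
      have in_T: "\<zeta> \<in> T" "\<zeta>' \<in> T" "\<zeta> \<noteq> \<zeta>'" "dist \<zeta> \<zeta>' \<le> chain_step \<epsilon> n"
        using that pT by (auto simp: P_def)
      have "dist \<zeta>' \<zeta> * (b * h (w n)) \<le> chain_step \<epsilon> n * (b * h (w n))"
        using in_T h[of "w n"] w[of n] pos by (intro mult_right_mono) (auto simp: dist_commute)
      then have "prob (E n \<zeta> \<zeta>') \<le> \<P>(\<omega> in M. D \<zeta>' \<zeta> \<omega> > dist \<zeta>' \<zeta> * (b * h (w n)))"
        unfolding E_def by (intro finite_measure_mono) auto
      also have "\<dots> \<le> g (w n)" unfolding h_def using in_T w by (intro D_tail) auto
      finally show ?thesis by (simp add: emeasure_eq_measure ennreal_leI)
    qed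
    have bad_le: "emeasure M (bad n) \<le> (covering_number S (\<delta> n))\<^sup>2 * ennreal (g (w n))" for n
    proof -
      have "emeasure M (bad n) \<le> (\<Sum>(\<zeta>, \<zeta>')\<in>P n. emeasure M (E n \<zeta> \<zeta>'))"
        unfolding bad_def case_prod_unfold using finP by (intro emeasure_subadditive_finite) auto
      also have "\<dots> \<le> (\<Sum>(\<zeta>, \<zeta>')\<in>P n. ennreal (g (w n)))"
        using E_le by (intro sum_mono) auto
      also have "\<dots> = of_nat (card (P n)) * ennreal (g (w n))" by (simp add: case_prod_unfold)
      also have "\<dots> \<le> of_nat (card (p n ` T) * card (p (Suc n) ` T)) * ennreal (g (w n))"
        unfolding card_cartesian_product[symmetric] P_def
        using fin by (intro mult_right_mono of_nat_mono card_mono) auto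
      also have "\<dots> \<le> (covering_number S (\<delta> n))\<^sup>2 * ennreal (g (w n))"
        by (intro mult_right_mono card_le) auto
      finally show ?thesis .
    qed
    have bad0_le: "emeasure M bad0 \<le> ennreal (g y)"
      using X_tail[OF \<zeta>0 y] unfolding bad0_def h_def emeasure_eq_measure by (rule ennreal_leI)
    have good: "Y \<omega> < ennreal ((1 + \<epsilon>) * (b * (1 + 2 * sqrt y * \<alpha> + 2 * y * \<beta>)))"
      if \<omega>: "\<omega> \<in> space M" "\<omega> \<notin> bad0" "\<And>n. \<omega> \<notin> bad n" for \<omega>
    proof -
      have chain: "X (p n \<zeta>) \<omega> \<le> b * h y + (\<Sum>m<n. chain_step \<epsilon> m * (b * h (w m)))" if "\<zeta> \<in> T" for n \<zeta>
      proof (induction n)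
        case 0
        show ?case using \<omega>(1,2) by (simp add: p_def bad0_def)
      next
        case (Suc n)
        have "X (p (Suc n) \<zeta>) \<omega> \<le> X (p n \<zeta>) \<omega> + chain_step \<epsilon> n * (b * h (w n))"
        \<comment> \<open>Coinciding neighbours lie outside \<open>P n\<close>; for them the added
          term is merely nonnegative.\<close>
        proof (cases "p n \<zeta> = p (Suc n) \<zeta>")
          case True
          have "0 \<le> chain_step \<epsilon> n * (b * h (w n))"
            using pos h[of "w n"] w[of n] by (intro mult_nonneg_nonneg chain_step_nonneg) auto
          with True show ?thesis by simp
        next
          case False
          then have "(p n \<zeta>, p (Suc n) \<zeta>) \<in> P n" using that p_dist by (auto simp: P_def)
          then have "\<omega> \<notin> E n (p n \<zeta>) (p (Suc n) \<zeta>)" using \<omega>(3)[of n] by (auto simp: bad_def)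
          then show ?thesis
            using \<omega>(1) X_D[OF \<omega>(1), of "p (Suc n) \<zeta>" "p n \<zeta>"] by (simp add: E_def)
        qed
        with Suc show ?case by simp
      qed
      \<comment> \<open>The starting point contributes 1 to each coefficient, the chain contributes
        5/8 \<epsilon>, 2 \<epsilon> and 2 \<epsilon>.\<close>
      define Q where "Q = b * (1 + \<epsilon> * 5 / 8 + (1 + 2 * \<epsilon>) * (sqrt y * \<alpha>) + (1 + 2 * \<epsilon>) * (y * \<beta>))"
      have X_Q: "X (p n \<zeta>) \<omega> \<le> Q" if "\<zeta> \<in> T" for n \<zeta>
      proof -
        have "(\<Sum>m<n. chain_step \<epsilon> m * (b * h (w m))) = b * (\<Sum>m<n. chain_step \<epsilon> m * h (w m))"
          by (simp add: sum_distrib_left algebra_simps)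
        also have "\<dots> \<le> b * (\<epsilon> * (5 / 8 + 2 * (sqrt y * \<alpha>) + 2 * (y * \<beta>)))"
          unfolding h_def w_def using pos y by (intro mult_left_mono chain_sum_le) auto
        finally show ?thesis
          using chain[OF that, of n] by (simp add: Q_def h_def algebra_simps)
      qed
      have "Y \<omega> \<le> ennreal Q"
        unfolding Y_def using X_Q by (intro SUP_least) (auto intro!: ennreal_leI)
      also have "\<dots> < ennreal ((1 + \<epsilon>) * (b * (1 + 2 * sqrt y * \<alpha> + 2 * y * \<beta>)))"
      proof (rule ennreal_lessI)
        have nn: "0 \<le> sqrt y * \<alpha>" "0 \<le> y * \<beta>" using pos y by auto
        \<comment> \<open>The gap is positive already through 3/8 \<epsilon>, so the bound on
          \<open>Y \<omega>\<close> is strict and the event in the conclusion may be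
          non-strict.\<close>
        have eq: "(1 + \<epsilon>) * (b * (1 + 2 * sqrt y * \<alpha> + 2 * y * \<beta>)) - Q
            = b * (3 / 8 * \<epsilon> + sqrt y * \<alpha> + y * \<beta>)"
          by (simp add: Q_def algebra_simps)
        have "0 < b * (3 / 8 * \<epsilon> + sqrt y * \<alpha> + y * \<beta>)"
          using pos nn by (intro mult_pos_pos add_pos_nonneg) auto
        with eq show "Q < (1 + \<epsilon>) * (b * (1 + 2 * sqrt y * \<alpha> + 2 * y * \<beta>))" by linarith
        show "0 < (1 + \<epsilon>) * (b * (1 + 2 * sqrt y * \<alpha> + 2 * y * \<beta>))"
          using pos y by (intro mult_pos_pos add_pos_nonneg) auto
      qed
      finally show ?thesis .
    qed
    have "{\<omega> \<in> space M. ennreal ((1 + \<epsilon>) * (b * (1 + 2 * sqrt y * \<alpha> + 2 * y * \<beta>))) \<le> Y \<omega>}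
        \<subseteq> bad0 \<union> (\<Union>n. bad n)"
      using good by (auto simp: not_less[symmetric])
    then have "emeasure M {\<omega> \<in> space M. ennreal ((1 + \<epsilon>) * (b * (1 + 2 * sqrt y * \<alpha> + 2 * y * \<beta>))) \<le> Y \<omega>}
        \<le> emeasure M (bad0 \<union> (\<Union>n. bad n))"
      by (intro emeasure_mono) auto
    also have "\<dots> \<le> emeasure M bad0 + emeasure M (\<Union>n. bad n)"
      by (intro emeasure_subadditive) auto
    also have "\<dots> \<le> emeasure M bad0 + (\<Sum>n. emeasure M (bad n))"
      by (intro add_left_mono emeasure_subadditive_countably) auto
    also have "\<dots> \<le> ennreal (g y) + (\<Sum>n. (covering_number S (\<delta> n))\<^sup>2 * ennreal (g (w n)))"
      by (intro add_mono bad0_le suminf_le bad_le) auto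
    also have "\<dots> \<le> L_series g \<epsilon> S y"
      unfolding \<delta>_def w_def by (rule L_series_ge)
    finally show ?thesis .
  qed
  show thesis by (rule that[OF Y_meas X_le_Y tail])
qed

section \<open>Moments from tails\<close>

lemma nn_integral_powr_shifted:
  fixes w q :: real
  assumes "0 \<le> w" "1 \<le> q"
  shows "(\<integral>\<^sup>+x\<in>{1<..1 + w}. ennreal ((x - 1) powr (q - 1)) \<partial>lborel) = ennreal (w powr q / q)"
proof -
  have I: "((\<lambda>x. x powr (q - 1)) has_integral (w powr q / q)) {0..w}"
    using has_integral_powr_from_0[of "q - 1" w] assms by simp
  have "(\<integral>\<^sup>+x. ennreal (x powr (q - 1)) * indicator {0..w} x \<partial>lborel)
      = (\<integral>\<^sup>+x. ennreal (indicator {0..w} x * x powr (q - 1)) \<partial>lborel)"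
    by (intro nn_integral_cong) (simp add: indicator_def)
  also have "\<dots> = ennreal (w powr q / q)"
    by (rule nn_integral_has_integral_lebesgue[OF _ I]) simp
  finally have "(\<integral>\<^sup>+x. ennreal (x powr (q - 1)) * indicator {0..w} x \<partial>lborel) = ennreal (w powr q / q)" .
  moreover have "(\<integral>\<^sup>+x\<in>{1<..1 + w}. ennreal ((x - 1) powr (q - 1)) \<partial>lborel)
      = (\<integral>\<^sup>+x. ennreal (x powr (q - 1)) * indicator {0..w} x \<partial>lborel)"
    by (subst nn_integral_real_affine[of _ 1 1])
       (auto intro!: nn_integral_cong simp: indicator_def)
  ultimately show ?thesis by simp
qed

text \<open>The layer-cake formula with levels measured in units of \<open>c\<close>: for finite v =
  t \<ge> c, the power (t - c)^q is c^q times the integral of q (x - 1)^(q-1) over x from 1 to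
  t/c.\<close>

lemma ennreal_powr_le_tail_integral:
  fixes c q :: real and v :: ennreal
  assumes c: "0 < c" and q: "1 \<le> q"
  shows "ennreal_powr (v - ennreal c) q \<le> ennreal (c powr q) *
     (ennreal q * (\<integral>\<^sup>+x\<in>{1<..}. ennreal ((x - 1) powr (q - 1)) * indicator {x. ennreal (c * x) \<le> v} x \<partial>lborel))"
    (is "_ \<le> ?R v")
proof -
  have fin: "ennreal ((t - c) powr q) \<le> ?R (ennreal t)" if "c \<le> t" for t
  proof -
    have w: "0 \<le> t / c - 1" using that c by (simp add: field_simps)
    have "ennreal ((t - c) powr q) = ennreal (c powr q * (q * ((t / c - 1) powr q / q)))"
    proof -
      have "t - c = c * (t / c - 1)" using c by (simp add: field_simps)
      then show ?thesis using c q powr_mult[of c "t / c - 1" q] by simp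
    qed
    also have "\<dots> = ennreal (c powr q) * (ennreal q *
        (\<integral>\<^sup>+x\<in>{1<..1 + (t / c - 1)}. ennreal ((x - 1) powr (q - 1)) \<partial>lborel))"
      unfolding nn_integral_powr_shifted[OF w q] using q by (simp add: ennreal_mult[symmetric])
    also have "\<dots> \<le> ?R (ennreal t)"
      using c that by (intro mult_left_mono nn_integral_mono)
        (auto simp: indicator_def field_simps intro!: ennreal_leI)
    finally show ?thesis .
  qed
  show ?thesis
  proof (cases v)
    case (real t)
    show ?thesis
    proof (cases "c \<le> t")
      case True
      have "ennreal t - ennreal c = ennreal (t - c)"
        using c by (intro ennreal_minus) auto
      then show ?thesis using fin[OF True] True real by (simp add: ennreal_powr_def)
    next
      case False
      then have "v - ennreal c = 0" using real by (intro diff_eq_0_ennreal) (auto intro!: ennreal_leI)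
      then show ?thesis by (simp add: ennreal_powr_def)
    qed
  next
    case top
    \<comment> \<open>For infinite \<open>v\<close> the right side dominates its value at every
      finite level n + c, which is at least n^q \<ge> n, and so is infinite.\<close>
    have "of_nat n \<le> ?R top" for n
    proof (cases "n = 0")
      case False
      have "of_nat n \<le> ennreal ((real n + c - c) powr q)"
        using False q powr_mono[of 1 q "real n"] by (simp add: ennreal_of_nat_eq_real_of_nat ennreal_leI)
      also have "\<dots> \<le> ?R (ennreal (real n + c))" by (rule fin) simp
      also have "\<dots> \<le> ?R top"
        by (intro mult_left_mono nn_integral_mono) (auto simp: indicator_def)
      finally show ?thesis .
    qed simp
    moreover have "K = top" if "\<And>n. of_nat n \<le> K" for K :: ennreal
      using that ennreal_Ex_less_of_nat[of K] by (metis less_top not_le)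
    ultimately have "?R top = top" by blast
    then show ?thesis unfolding top by (simp only: top_greatest)
  qed
qed

text \<open>The layer-cake bound is integrated over \<omega> and the integrals are exchanged; the
  inner one becomes the probability of the level event, to which \<open>tail\<close>
  applies.\<close>

lemma (in prob_space) moment_le_tail_integral:
  fixes Y :: "'a \<Rightarrow> ennreal" and F :: "real \<Rightarrow> ennreal"
  assumes Y[measurable]: "Y \<in> borel_measurable M" and c: "0 < c" and q: "1 \<le> q"
    and tail: "\<And>x. 1 < x \<Longrightarrow> emeasure M {\<omega> \<in> space M. ennreal (c * x) \<le> Y \<omega>} \<le> F x"
  shows "(\<integral>\<^sup>+\<omega>. ennreal_powr (Y \<omega> - ennreal c) q \<partial>M) \<le> ennreal (c powr q) *
     (ennreal q * (\<integral>\<^sup>+x\<in>{1<..}. ennreal ((x - 1) powr (q - 1)) * F x \<partial>lborel))"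
proof -
  interpret pair_sigma_finite M lborel ..
  define f where "f \<omega> x = ennreal ((x - 1) powr (q - 1)) * indicator {x. ennreal (c * x) \<le> Y \<omega>} x
      * indicator {1<..} x" for \<omega> x
  \<comment> \<open>Written as a conditional, the integrand is visibly jointly measurable, as the
    exchange demands.\<close>
  have f_eq: "f \<omega> x = (if ennreal (c * x) \<le> Y \<omega> then ennreal ((x - 1) powr (q - 1)) * indicator {1<..} x else 0)"
    for \<omega> x by (simp add: f_def indicator_def)
  have f[measurable]: "case_prod f \<in> borel_measurable (M \<Otimes>\<^sub>M lborel)"
    unfolding f_eq case_prod_unfold by measurable
  have "(\<integral>\<^sup>+\<omega>. ennreal_powr (Y \<omega> - ennreal c) q \<partial>M)
      \<le> (\<integral>\<^sup>+\<omega>. ennreal (c powr q) * (ennreal q * (\<integral>\<^sup>+x. f \<omega> x \<partial>lborel)) \<partial>M)"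
    unfolding f_def by (intro nn_integral_mono ennreal_powr_le_tail_integral c q)
  also have "\<dots> = ennreal (c powr q) * (ennreal q * (\<integral>\<^sup>+\<omega>. (\<integral>\<^sup>+x. f \<omega> x \<partial>lborel) \<partial>M))"
    by (simp add: nn_integral_cmult)
  also have "(\<integral>\<^sup>+\<omega>. (\<integral>\<^sup>+x. f \<omega> x \<partial>lborel) \<partial>M) = (\<integral>\<^sup>+x. (\<integral>\<^sup>+\<omega>. f \<omega> x \<partial>M) \<partial>lborel)"
    by (rule Fubini'[OF f, symmetric])
  also have "\<dots> \<le> (\<integral>\<^sup>+x\<in>{1<..}. ennreal ((x - 1) powr (q - 1)) * F x \<partial>lborel)"
  proof (rule nn_integral_mono)
    fix x :: real
    have "(\<integral>\<^sup>+\<omega>. f \<omega> x \<partial>M) = (\<integral>\<^sup>+\<omega>. ennreal ((x - 1) powr (q - 1)) * indicator {1<..} x *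
        indicator {\<omega> \<in> space M. ennreal (c * x) \<le> Y \<omega>} \<omega> \<partial>M)"
      by (intro nn_integral_cong) (auto simp: f_eq indicator_def)
    also have "\<dots> = ennreal ((x - 1) powr (q - 1)) * indicator {1<..} x *
        emeasure M {\<omega> \<in> space M. ennreal (c * x) \<le> Y \<omega>}"
      by (rule nn_integral_cmult_indicator) measurable
    also have "\<dots> \<le> ennreal ((x - 1) powr (q - 1)) * F x * indicator {1<..} x"
      using tail[of x] by (auto simp: indicator_def intro!: mult_left_mono)
    finally show "(\<integral>\<^sup>+\<omega>. f \<omega> x \<partial>M) \<le> ennreal ((x - 1) powr (q - 1)) * F x * indicator {1<..} x" .
  qed
  finally show ?thesis by (simp add: mult_left_mono)
qed

section \<open>The majorant on a slice\<close>

lemma modulus_slice_le_sup_modulus: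
  assumes "0 < r" "r \<le> b" "ennreal b \<le> R"
  shows "modulus \<phi> F (slice \<phi> U Z b) \<le> ennreal b * sup_modulus \<phi> U Z r R F"
proof -
  have "modulus \<phi> F (slice \<phi> U Z b) / ennreal b \<le> sup_modulus \<phi> U Z r R F"
    unfolding sup_modulus_def using assms by (intro SUP_upper) auto
  then have "ennreal b * (modulus \<phi> F (slice \<phi> U Z b) / ennreal b) \<le> ennreal b * sup_modulus \<phi> U Z r R F"
    by (rule mult_left_mono) simp
  moreover have "ennreal b \<noteq> 0" using assms by (simp add: ennreal_eq_0_iff)
  then have "ennreal b * (modulus \<phi> F (slice \<phi> U Z b) / ennreal b) = modulus \<phi> F (slice \<phi> U Z b)"
    by (simp add: ennreal_times_divide mult.commute[of "ennreal b"] mult_divide_eq_ennreal)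
  ultimately show ?thesis by simp
qed

text \<open>The hypotheses of \<open>chaining\<close> are met: linearity of the path turns
  sub-additivity into \<open>X_D\<close>, its continuity with the open superlevel sets of \<Psi>
  gives \<open>X_lsc\<close>. The threshold of \<open>bernstein_tail\<close> is linear in the values
  of \<open>U\<close>, \<open>A\<close>, \<open>B\<close>, so bounds proportional to the distance
  give thresholds proportional to it.\<close>

lemma (in prob_space) slice_majorant:
  fixes \<xi> :: "'h::linear_topological_space \<Rightarrow> 'a \<Rightarrow> 's::linear_topological_space"
    and \<phi> :: "'z::metric_space \<Rightarrow> 'h"
  assumes xi_linear: "\<And>\<omega>. \<omega> \<in> space M \<Longrightarrow> linear (\<lambda>\<theta>. \<xi> \<theta> \<omega>)"
    and xi_continuous: "\<And>\<omega>. \<omega> \<in> space M \<Longrightarrow> continuous_on UNIV (\<lambda>\<theta>. \<xi> \<theta> \<omega>)"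
    and xi_measurable: "\<And>\<theta>. \<xi> \<theta> \<in> borel_measurable M"
    and Psi_nonneg: "\<And>s. 0 \<le> \<Psi> s"
    and Psi_subadditive: "\<And>s t. \<Psi> (s + t) \<le> \<Psi> s + \<Psi> t"
    and Psi_lsc: "\<And>c::real. open {s. c < \<Psi> s}"
    and A: "\<And>\<theta>. 0 \<le> A \<theta>" and B: "\<And>\<theta>. 0 \<le> B \<theta>"
    and g: "\<And>x. 0 \<le> x \<Longrightarrow> 0 \<le> g x" "antimono_on {0..} g"
    and tail_bound: "\<And>z \<theta>. 0 < z \<Longrightarrow>
          \<P>(\<omega> in M. \<Psi> (\<xi> \<theta> \<omega>) - U \<theta> \<ge> z) \<le> g_ratio g (z\<^sup>2) ((A \<theta>)\<^sup>2 + B \<theta> * z)"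
    and phi_continuous: "continuous_on UNIV \<phi>"
    and mU: "modulus \<phi> U S \<le> ennreal b"
    and mA: "modulus \<phi> A S \<le> ennreal (b * \<alpha>)"
    and mB: "modulus \<phi> B S \<le> ennreal (b * \<beta>)"
    and S: "totally_bounded S" "T \<subseteq> S" "T \<subseteq> cball c (\<epsilon> / 8)"
    and pos: "0 < \<epsilon>" "0 < b" "0 \<le> \<alpha>" "0 \<le> \<beta>"
  obtains Y :: "'a \<Rightarrow> ennreal" where "Y \<in> borel_measurable M"
    "\<And>\<zeta> \<omega>. \<zeta> \<in> T \<Longrightarrow> \<omega> \<in> space M \<Longrightarrow> ennreal (\<Psi> (\<xi> (\<phi> \<zeta>) \<omega>)) \<le> Y \<omega>"
    "\<And>y. 0 < y \<Longrightarrow>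
      emeasure M {\<omega> \<in> space M. ennreal ((1 + \<epsilon>) * (b * (1 + 2 * sqrt y * \<alpha> + 2 * y * \<beta>))) \<le> Y \<omega>}
        \<le> L_series g \<epsilon> S y"
proof -
  have [measurable]: "\<Psi> \<in> borel_measurable borel"
    unfolding borel_measurable_iff_greater using Psi_lsc by simp
  note xi_measurable[measurable]
  have tail: "\<P>(\<omega> in M. \<Psi> (\<xi> \<theta> \<omega>) > t) \<le> g s"
    if "0 < s" "U \<theta> + sqrt s * A \<theta> + s * B \<theta> \<le> t" for \<theta> s t
  proof -
    have "\<P>(\<omega> in M. \<Psi> (\<xi> \<theta> \<omega>) > t) \<le> \<P>(\<omega> in M. \<Psi> (\<xi> \<theta> \<omega>) > U \<theta> + sqrt s * A \<theta> + s * B \<theta>)"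
      using that(2) by (intro finite_measure_mono) auto
    also have "\<dots> \<le> g s"
      by (intro bernstein_tail[where Y = "\<lambda>\<omega>. \<Psi> (\<xi> \<theta> \<omega>)"] tail_bound A B g that(1)) measurable
    finally show ?thesis .
  qed
  have b0: "0 \<le> b" "0 \<le> b * \<alpha>" "0 \<le> b * \<beta>" using pos by auto
  show thesis
  proof (rule chaining[where X = "\<lambda>\<zeta> \<omega>. \<Psi> (\<xi> (\<phi> \<zeta>) \<omega>)"
        and D = "\<lambda>\<zeta> \<zeta>' \<omega>. \<Psi> (\<xi> (\<phi> \<zeta> - \<phi> \<zeta>') \<omega>)" and T = T and b = b
        and \<alpha> = \<alpha> and \<beta> = \<beta> and g = g and S = S and c = c and \<epsilon> = \<epsilon>])
    show "\<Psi> (\<xi> (\<phi> \<zeta>) \<omega>) \<le> \<Psi> (\<xi> (\<phi> \<zeta>') \<omega>) + \<Psi> (\<xi> (\<phi> \<zeta> - \<phi> \<zeta>') \<omega>)" if "\<omega> \<in> space M" for \<zeta> \<zeta>' \<omega>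
      using Psi_subadditive[of "\<xi> (\<phi> \<zeta>') \<omega>" "\<xi> (\<phi> \<zeta> - \<phi> \<zeta>') \<omega>"]
      by (simp add: linear_diff[OF xi_linear[OF that]])
    show "\<Psi> (\<xi> (\<phi> \<zeta>) \<omega>) \<le> t"
      if "\<omega> \<in> space M" and x: "x \<longlonglongrightarrow> \<zeta>" and le: "\<And>n::nat. \<Psi> (\<xi> (\<phi> (x n)) \<omega>) \<le> t" for \<omega> x \<zeta> t
    proof (rule ccontr)
      assume "\<not> ?thesis"
      then have mem: "\<xi> (\<phi> \<zeta>) \<omega> \<in> {s. t < \<Psi> s}" by simp
      have "(\<lambda>n. \<phi> (x n)) \<longlonglongrightarrow> \<phi> \<zeta>"
        using continuous_on_tendsto_compose[OF phi_continuous x] by simp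
      then have "(\<lambda>n. \<xi> (\<phi> (x n)) \<omega>) \<longlonglongrightarrow> \<xi> (\<phi> \<zeta>) \<omega>"
        using continuous_on_tendsto_compose[OF xi_continuous[OF that(1)]] by simp
      then have "\<forall>\<^sub>F n in sequentially. \<xi> (\<phi> (x n)) \<omega> \<in> {s. t < \<Psi> s}"
        using Psi_lsc mem by (rule topological_tendstoD)
      then obtain n where "t < \<Psi> (\<xi> (\<phi> (x n)) \<omega>)"
        unfolding eventually_sequentially by auto
      with le[of n] show False by simp
    qed
    show "\<P>(\<omega> in M. b * (1 + sqrt s * \<alpha> + s * \<beta>) < \<Psi> (\<xi> (\<phi> \<zeta>) \<omega>)) \<le> g s" if "\<zeta> \<in> T" "0 < s" for \<zeta> s
    proof (rule tail[OF that(2)])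
      have "\<zeta> \<in> S" using that S by auto
      from modulus_le_imp_value_le[OF mU b0(1) this] modulus_le_imp_value_le[OF mA b0(2) this]
        modulus_le_imp_value_le[OF mB b0(3) this]
      have "U (\<phi> \<zeta>) + sqrt s * A (\<phi> \<zeta>) + s * B (\<phi> \<zeta>) \<le> b + sqrt s * (b * \<alpha>) + s * (b * \<beta>)"
        using that(2) by (intro add_mono mult_left_mono) auto
      then show "U (\<phi> \<zeta>) + sqrt s * A (\<phi> \<zeta>) + s * B (\<phi> \<zeta>) \<le> b * (1 + sqrt s * \<alpha> + s * \<beta>)"
        by (simp add: algebra_simps)
    qed
    show "\<P>(\<omega> in M. dist \<zeta> \<zeta>' * (b * (1 + sqrt s * \<alpha> + s * \<beta>)) < \<Psi> (\<xi> (\<phi> \<zeta> - \<phi> \<zeta>') \<omega>)) \<le> g s"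
      if "\<zeta> \<in> T" "\<zeta>' \<in> T" "\<zeta> \<noteq> \<zeta>'" "0 < s" for \<zeta> \<zeta>' s
    proof (rule tail[OF that(4)])
      let ?\<theta> = "\<phi> \<zeta> - \<phi> \<zeta>'" and ?d = "dist \<zeta> \<zeta>'"
      have "\<zeta> \<in> S" "\<zeta>' \<in> S" using that S by auto
      note incr = modulus_le_imp_increment_le[OF _ _ this that(3)]
      from incr[OF mU b0(1)] incr[OF mA b0(2)] incr[OF mB b0(3)]
      have "U ?\<theta> + sqrt s * A ?\<theta> + s * B ?\<theta> \<le> b * ?d + sqrt s * (b * \<alpha> * ?d) + s * (b * \<beta> * ?d)"
        using that(4) by (intro add_mono mult_left_mono) auto
      then show "U ?\<theta> + sqrt s * A ?\<theta> + s * B ?\<theta> \<le> ?d * (b * (1 + sqrt s * \<alpha> + s * \<beta>))"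
        by (simp add: algebra_simps)
    qed
  qed (use Psi_nonneg S pos that in auto)
qed

section \<open>Assembling the slices\<close>

lemma ennreal_powr_mono: "x \<le> y \<Longrightarrow> 0 \<le> q \<Longrightarrow> ennreal_powr x q \<le> ennreal_powr y q"
  by (auto simp: ennreal_powr_def top_unique less_top intro!: ennreal_leI powr_mono2 enn2real_mono)

lemma measurable_ennreal_powr[measurable (raw)]:
  assumes [measurable]: "f \<in> borel_measurable M"
  shows "(\<lambda>x. ennreal_powr (f x) q) \<in> borel_measurable M"
  unfolding ennreal_powr_def by measurable

theorem proposition2:
  fixes M :: "'w measure"
    and \<xi> :: "'h::linear_topological_space \<Rightarrow> 'w \<Rightarrow> 's::linear_topological_space"
    and \<Psi> :: "'s \<Rightarrow> real"
    and \<Theta> :: "'h set"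
    and A B U :: "'h \<Rightarrow> real"
    and g :: "real \<Rightarrow> real"
    and \<phi> :: "'z::metric_space \<Rightarrow> 'h"
    and Z :: "'z set"
    and r :: real and R :: ennreal
    and \<epsilon> y q u :: real
    and C :: ennreal and J :: nat and a :: "nat \<Rightarrow> real"
  assumes "prob_space M" and "complete_measure M"
    and xi_linear: "\<And>\<omega>. \<omega> \<in> space M \<Longrightarrow> linear (\<lambda>\<theta>. \<xi> \<theta> \<omega>)"
    and xi_continuous: "\<And>\<omega>. \<omega> \<in> space M \<Longrightarrow> continuous_on UNIV (\<lambda>\<theta>. \<xi> \<theta> \<omega>)"
    and xi_measurable: "\<And>\<theta>. \<xi> \<theta> \<in> borel_measurable M"
    and Psi_nonneg: "\<And>s. 0 \<le> \<Psi> s"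
    and Psi_subadditive: "\<And>s t. \<Psi> (s + t) \<le> \<Psi> s + \<Psi> t"
    and Psi_lower_semicontinuous: "\<And>c. open {s. c < \<Psi> s}"
    and "\<And>\<theta>. 0 \<le> A \<theta>" and "\<And>\<theta>. 0 \<le> B \<theta>" and "\<And>\<theta>. 0 \<le> U \<theta>"
    and "\<And>x. 0 \<le> x \<Longrightarrow> 0 \<le> g x"
    and tail_bound: "\<And>z \<theta>. 0 < z \<Longrightarrow>
          \<P>(\<omega> in M. \<Psi> (\<xi> \<theta> \<omega>) - U \<theta> \<ge> z) \<le> g_ratio g (z\<^sup>2) ((A \<theta>)\<^sup>2 + B \<theta> * z)"
    and g_decreasing: "antimono_on {0..} g" and g_limit: "(g \<longlongrightarrow> 0) at_top"
    and r_eq: "ennreal r = (INF \<theta>\<in>\<Theta>. ennreal (U \<theta>))"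
    and R_eq: "R = (SUP \<theta>\<in>\<Theta>. ennreal (U \<theta>))"
    and "0 < r" and "ennreal r \<le> R"
    and Z_totally_bounded: "totally_bounded Z"
    and phi_continuous: "continuous_on UNIV \<phi>"
    and Theta_eq: "\<Theta> = \<phi> ` Z"
    and kappa_finite: "modulus \<phi> U Z < \<infinity>"
    and kappa_le: "\<And>a. r \<le> a \<Longrightarrow> ennreal a \<le> R \<Longrightarrow> modulus \<phi> U (slice \<phi> U Z a) \<le> ennreal a"
    and "0 < \<epsilon>" and "\<epsilon> \<le> 1"
    and boundary: "\<epsilon> = 1 \<Longrightarrow> \<forall>\<theta>\<in>\<Theta>. r < U \<theta>"
    and "0 < y" and "1 \<le> q"
    and u_eq: "u = 2 powr \<epsilon> * (1 + \<epsilon>)"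
    and C_eq: "C = C_star \<phi> U A B Z r R y"
    and J_eq: "J = last_slice r R \<epsilon>"
    and a_eq: "\<And>j. a j = r * 2 powr (\<epsilon> * (real j + 1))"
  shows "ennreal (\<P>(\<omega> in M. Psi_star \<Psi> \<xi> U \<phi> Z u C \<omega> \<ge> 0))
           \<le> covering_number Z (\<epsilon> / 8) * (\<Sum>j = 0..J. L_series g \<epsilon> (slice \<phi> U Z (a j)) y)
       \<and> (\<integral>\<^sup>+\<omega>. ennreal_powr (e2ennreal (max 0 (Psi_star \<Psi> \<xi> U \<phi> Z u C \<omega>))) q \<partial>M)
           \<le> covering_number Z (\<epsilon> / 8) * ennreal_powr (ennreal u * C) q *
             (\<Sum>j = 0..J. ennreal (a j powr q) * J_integral g \<epsilon> q (slice \<phi> U Z (a j)) y)"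
proof -
  interpret prob_space M by fact
  note A0 = \<open>\<And>\<theta>. 0 \<le> A \<theta>\<close> and B0 = \<open>\<And>\<theta>. 0 \<le> B \<theta>\<close> and U0 = \<open>\<And>\<theta>. 0 \<le> U \<theta>\<close>
  note g0 = \<open>\<And>x. 0 \<le> x \<Longrightarrow> 0 \<le> g x\<close>
  note r = \<open>0 < r\<close> and eps = \<open>0 < \<epsilon>\<close> \<open>\<epsilon> \<le> 1\<close> and y = \<open>0 < y\<close> and q = \<open>1 \<le> q\<close>
  \<comment> \<open>The infimum over an empty set would be infinite, whereas \<open>r\<close> is
    real.\<close>
  have "Z \<noteq> {}" using r_eq Theta_eq by auto
  \<comment> \<open>The value part of the modulus dominates \<open>R\<close>, so
    \<open>kappa_finite\<close> makes \<open>R\<close> a real number.\<close>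
  have "R \<le> modulus \<phi> U Z"
    unfolding R_eq Theta_eq modulus_def by (simp add: image_image)
  then have "R < top" using kappa_finite by (metis infinity_ennreal_def order_le_less_trans)
  then obtain R' where R': "R = ennreal R'" "0 \<le> R'" by (cases R) auto
  have rR: "r \<le> R'" using \<open>ennreal r \<le> R\<close> R' by (simp add: ennreal_le_iff)
  have U_ge: "r \<le> U (\<phi> \<zeta>)" if "\<zeta> \<in> Z" for \<zeta>
  proof -
    have "ennreal r \<le> ennreal (U (\<phi> \<zeta>))"
      unfolding r_eq Theta_eq using that by (intro INF_lower) auto
    then show ?thesis using U0 by (simp add: ennreal_le_iff)
  qed
  have U_le: "U (\<phi> \<zeta>) \<le> R'" if "\<zeta> \<in> Z" for \<zeta>
  proof -
    have "ennreal (U (\<phi> \<zeta>)) \<le> R"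
      unfolding R_eq Theta_eq using that by (intro SUP_upper) auto
    then show ?thesis using R' by (simp add: ennreal_le_iff)
  qed
  have u: "0 < u" "1 + \<epsilon> \<le> u"
    using eps ge_one_powr_ge_zero[of 2 \<epsilon>] mult_right_mono[of 1 "2 powr \<epsilon>" "1 + \<epsilon>"] by (auto simp: u_eq)
  show ?thesis
  proof (cases "C = top")
    \<comment> \<open>For infinite \<open>C\<close> every term is -infinity because U \<ge> r > 0 on
      the image of \<open>Z\<close>; both left sides are then 0.\<close>
    case True
    have inf: "enn2ereal (ennreal u * C * ennreal (U (\<phi> \<zeta>))) = \<infinity>" if "\<zeta> \<in> Z" for \<zeta>
    proof -
      have "0 < U (\<phi> \<zeta>)" using U_ge[OF that] r by simp
      then have "ennreal u * C * ennreal (U (\<phi> \<zeta>)) = top"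
        using True u by (simp add: ennreal_mult_eq_top_iff ennreal_eq_0_iff)
      then show ?thesis by simp
    qed
    have neg: "Psi_star \<Psi> \<xi> U \<phi> Z u C \<omega> = -\<infinity>" for \<omega>
      unfolding Psi_star_def using \<open>Z \<noteq> {}\<close> inf by simp
    show ?thesis unfolding neg by (simp add: ennreal_powr_def)
  next
    case False
    define \<alpha> where "\<alpha> = enn2real (sup_modulus \<phi> U Z r R A)"
    define \<beta> where "\<beta> = enn2real (sup_modulus \<phi> U Z r R B)"
    have ab0: "0 \<le> \<alpha>" "0 \<le> \<beta>" by (auto simp: \<alpha>_def \<beta>_def)
    \<comment> \<open>As \<open>y\<close> is positive, no factor 0 can hide an infinite supremum in
      \<open>C\<close>.\<close>
    have fin: "sup_modulus \<phi> U Z r R A \<noteq> top" "sup_modulus \<phi> U Z r R B \<noteq> top"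
      using False y unfolding C_eq C_star_def
      by (auto simp: ennreal_mult_eq_top_iff ennreal_eq_0_iff)
    have supA: "sup_modulus \<phi> U Z r R A = ennreal \<alpha>" and supB: "sup_modulus \<phi> U Z r R B = ennreal \<beta>"
      using fin by (simp_all add: \<alpha>_def \<beta>_def less_top)
    define h where "h t = 1 + 2 * sqrt t * \<alpha> + 2 * t * \<beta>" for t
    have h1: "1 \<le> h t" if "0 \<le> t" for t using that ab0 by (simp add: h_def)
    have C: "C = ennreal (h y)"
    proof -
      have "2 * ennreal (sqrt y) * ennreal \<alpha> = ennreal (2 * sqrt y * \<alpha>)"
        and "2 * ennreal y * ennreal \<beta> = ennreal (2 * y * \<beta>)"
        using ab0 y by (simp_all add: ennreal_mult)
      then show ?thesis
        unfolding C_eq C_star_def supA supB h_def using ab0 y by (simp flip: ennreal_1)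
    qed

    \<comment> \<open>Geometric scales\<close>
    have a_pos: "0 < a j" and a_ge: "r \<le> a j" for j
      using r eps ge_one_powr_ge_zero[of 2 "\<epsilon> * (real j + 1)"] mult_left_mono[of 1 "2 powr (\<epsilon> * (real j + 1))" r]
      by (auto simp: a_eq)
    have a_Suc: "a (Suc j) = a j * 2 powr \<epsilon>" for j
      by (simp add: a_eq powr_add[symmetric] algebra_simps)
    have a_0: "a 0 = r * 2 powr \<epsilon>" by (simp add: a_eq)
    have pow2: "2 powr \<epsilon> \<le> 2" using eps powr_mono[of \<epsilon> 1 2] by simp
    \<comment> \<open>The -1 in \<open>last_slice\<close> matches the exponent j + 1 in
      \<open>a\<close>: scale \<open>J\<close> reaches \<open>R'\<close>.\<close>
    have a_J: "R' \<le> a J"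
    proof -
      have "log 2 (R' / r) / \<epsilon> - 1 \<le> real J"
        unfolding J_eq last_slice_def using R' by (simp add: le_nat_iff) linarith
      then have "log 2 (R' / r) \<le> \<epsilon> * (real J + 1)" using eps by (simp add: field_simps)
      then have "R' / r \<le> 2 powr (\<epsilon> * (real J + 1))"
        using r rR by (simp add: log_le_iff)
      then show ?thesis using r by (simp add: a_eq field_simps)
    qed
    have index: "\<exists>j\<le>J. \<zeta> \<in> slice \<phi> U Z (a j) \<and> a j \<le> 2 powr \<epsilon> * U (\<phi> \<zeta>)" if \<zeta>: "\<zeta> \<in> Z" for \<zeta>
    proof -
      \<comment> \<open>Minimality puts the preceding scale below \<open>U\<close>, so
        \<open>a j\<close> is less than 2^\<epsilon> U \<le> 2 U. The first bound compares
        \<open>a j\<close> with \<open>U\<close>, the second is the lower end of the slice.\<close>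
      define j where "j = (LEAST j. U (\<phi> \<zeta>) \<le> a j)"
      have J: "U (\<phi> \<zeta>) \<le> a J" using U_le[OF \<zeta>] a_J by simp
      have j: "U (\<phi> \<zeta>) \<le> a j" "j \<le> J"
        unfolding j_def using J by (rule LeastI, rule Least_le)
      have "a j \<le> 2 powr \<epsilon> * U (\<phi> \<zeta>) \<and> a j < 2 * U (\<phi> \<zeta>)"
      proof (cases j)
        case 0
        \<comment> \<open>Scale 0 has no predecessor, only U \<ge> r. Strictness comes from
          2^\<epsilon> < 2 when \<epsilon> < 1, and from \<open>boundary\<close> when \<epsilon> =
          1.\<close>
        have "r * 2 powr \<epsilon> < 2 * U (\<phi> \<zeta>)"
        proof (cases "\<epsilon> = 1")
          case True
          then show ?thesis using boundary \<zeta> by (simp add: Theta_eq)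
        next
          case False
          then have "r * 2 powr \<epsilon> < r * 2"
            using r eps powr_less_mono[of \<epsilon> 1 2] by simp
          then show ?thesis using U_ge[OF \<zeta>] by simp
        qed
        then show ?thesis using 0 a_0 U_ge[OF \<zeta>] by (simp add: mult.commute)
      next
        case (Suc i)
        then have "a i < U (\<phi> \<zeta>)" using not_less_Least[of i "\<lambda>j. U (\<phi> \<zeta>) \<le> a j"] by (simp add: j_def)
        then have "a j < U (\<phi> \<zeta>) * 2 powr \<epsilon>" using Suc a_Suc by simp
        moreover have "U (\<phi> \<zeta>) * 2 powr \<epsilon> \<le> U (\<phi> \<zeta>) * 2" using pow2 U0 by (rule mult_left_mono)
        ultimately show ?thesis by (simp add: mult.commute)
      qed
      with j \<zeta> show ?thesis by (auto simp: slice_def)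
    qed

    have moduli: "modulus \<phi> U (slice \<phi> U Z (a j)) \<le> ennreal (a j)"
        "modulus \<phi> A (slice \<phi> U Z (a j)) \<le> ennreal (a j * \<alpha>)"
        "modulus \<phi> B (slice \<phi> U Z (a j)) \<le> ennreal (a j * \<beta>)" for j
    proof -
      \<comment> \<open>The last scale may exceed \<open>R\<close>, where no modulus is controlled.\<close>
      define b where "b = min (a j) R'"
      have b: "r \<le> b" "b \<le> R'" "b \<le> a j" "0 < b" using a_ge a_pos rR r by (auto simp: b_def)
      then have bR: "ennreal b \<le> R" using R' by (simp add: ennreal_leI)
      \<comment> \<open>Lowering the scale to \<open>b\<close> loses no point: U \<le> R' on
        \<open>Z\<close>, and the lower end only drops.\<close>
      have sub: "slice \<phi> U Z (a j) \<subseteq> slice \<phi> U Z b"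
        using U_le by (auto simp: slice_def b_def)
      have "modulus \<phi> U (slice \<phi> U Z (a j)) \<le> modulus \<phi> U (slice \<phi> U Z b)" by (rule modulus_mono[OF sub])
      also have "\<dots> \<le> ennreal b" by (rule kappa_le[OF b(1) bR])
      also have "\<dots> \<le> ennreal (a j)" using b by (intro ennreal_leI)
      finally show "modulus \<phi> U (slice \<phi> U Z (a j)) \<le> ennreal (a j)" .
      have F: "modulus \<phi> F (slice \<phi> U Z (a j)) \<le> ennreal (a j * l)"
        if "sup_modulus \<phi> U Z r R F = ennreal l" "0 \<le> l" for F l
      proof -
        have "modulus \<phi> F (slice \<phi> U Z (a j)) \<le> modulus \<phi> F (slice \<phi> U Z b)" by (rule modulus_mono[OF sub])
        also have "\<dots> \<le> ennreal b * ennreal l"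
          using modulus_slice_le_sup_modulus[OF r b(1) bR, of \<phi> F U Z] that by simp
        also have "\<dots> \<le> ennreal (a j * l)"
          using b that by (simp add: ennreal_mult[symmetric] ennreal_leI mult_right_mono)
        finally show ?thesis .
      qed
      show "modulus \<phi> A (slice \<phi> U Z (a j)) \<le> ennreal (a j * \<alpha>)"
        "modulus \<phi> B (slice \<phi> U Z (a j)) \<le> ennreal (a j * \<beta>)"
        using F supA supB ab0 by auto
    qed

    \<comment> \<open>A majorant for each scale and ball\<close>
    obtain K where K: "finite K" "Z \<subseteq> (\<Union>c\<in>K. cball c (\<epsilon> / 8))" "covering_number Z (\<epsilon> / 8) = of_nat (card K)"
      using covering_number_attained[OF Z_totally_bounded, of "\<epsilon> / 8"] eps by auto
    \<comment> \<open>Stated as a predicate so that one majorant, valid for all \<open>t\<close>,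
      can be chosen for every pair of scale and ball.\<close>
    define majorant where "majorant j c Y \<longleftrightarrow> Y \<in> borel_measurable M \<and>
        (\<forall>\<zeta>\<in>slice \<phi> U Z (a j) \<inter> cball c (\<epsilon> / 8). \<forall>\<omega>\<in>space M. ennreal (\<Psi> (\<xi> (\<phi> \<zeta>) \<omega>)) \<le> Y \<omega>) \<and>
        (\<forall>t>0. emeasure M {\<omega> \<in> space M. ennreal ((1 + \<epsilon>) * (a j * h t)) \<le> Y \<omega>}
            \<le> L_series g \<epsilon> (slice \<phi> U Z (a j)) t)" for j c Y
    have "\<exists>Y. majorant j c Y" for j c
    proof -
      have tb: "totally_bounded (slice \<phi> U Z (a j))"
        by (rule totally_bounded_subset[OF Z_totally_bounded]) (auto simp: slice_def)
      show ?thesis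
      proof (rule slice_majorant[where \<xi> = \<xi> and \<Psi> = \<Psi> and A = A and B = B and U = U and g = g and \<phi> = \<phi>
            and S = "slice \<phi> U Z (a j)" and T = "slice \<phi> U Z (a j) \<inter> cball c (\<epsilon> / 8)"
            and b = "a j" and \<alpha> = \<alpha> and \<beta> = \<beta> and \<epsilon> = \<epsilon> and c = c])
        fix Y :: "'w \<Rightarrow> ennreal" assume "Y \<in> borel_measurable M"
          "\<And>\<zeta> \<omega>. \<zeta> \<in> slice \<phi> U Z (a j) \<inter> cball c (\<epsilon> / 8) \<Longrightarrow> \<omega> \<in> space M \<Longrightarrow>
            ennreal (\<Psi> (\<xi> (\<phi> \<zeta>) \<omega>)) \<le> Y \<omega>"
          "\<And>y. 0 < y \<Longrightarrow>
            emeasure M {\<omega> \<in> space M. ennreal ((1 + \<epsilon>) * (a j * (1 + 2 * sqrt y * \<alpha> + 2 * y * \<beta>))) \<le> Y \<omega>}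
              \<le> L_series g \<epsilon> (slice \<phi> U Z (a j)) y"
        then have "majorant j c Y" unfolding majorant_def h_def by blast
        then show "\<exists>Y. majorant j c Y" by (rule exI[of _ Y])
      qed (fact | rule Int_lower1 Int_lower2 a_pos moduli ab0)+
    qed
    then obtain Y where Y: "\<And>j c. majorant j c (Y j c)" by metis
    have Y_meas[measurable]: "Y j c \<in> borel_measurable M" for j c
      using Y[of j c] by (simp add: majorant_def)
    have Y_ge: "ennreal (\<Psi> (\<xi> (\<phi> \<zeta>) \<omega>)) \<le> Y j c \<omega>"
      if "\<zeta> \<in> slice \<phi> U Z (a j) \<inter> cball c (\<epsilon> / 8)" "\<omega> \<in> space M" for j c \<zeta> \<omega>
      using Y[of j c] that by (simp add: majorant_def)
    have Y_tail: "emeasure M {\<omega> \<in> space M. ennreal ((1 + \<epsilon>) * (a j * h t)) \<le> Y j c \<omega>}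
        \<le> L_series g \<epsilon> (slice \<phi> U Z (a j)) t" if "0 < t" for j c t
      using Y[of j c] that by (simp add: majorant_def)
    define b where "b j = (1 + \<epsilon>) * (a j * h y)" for j
    have b_pos: "0 < b j" for j
      using eps a_pos h1[of y] y by (simp add: b_def)
    define I where "I = {0..J} \<times> K"
    have I: "finite I" using K by (simp add: I_def)
    \<comment> \<open>Here u = 2^\<epsilon> (1 + \<epsilon>) is spent: 1 + \<epsilon> is the slack
      of chaining, 2^\<epsilon> the loss in passing from \<open>a j\<close> to
      \<open>U\<close>.\<close>
    have I_cover: "\<exists>(j, c)\<in>I. \<zeta> \<in> slice \<phi> U Z (a j) \<inter> cball c (\<epsilon> / 8) \<and> b j \<le> u * h y * U (\<phi> \<zeta>)"
      if \<zeta>: "\<zeta> \<in> Z" for \<zeta>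
    proof -
      obtain j where j: "j \<le> J" "\<zeta> \<in> slice \<phi> U Z (a j)" "a j \<le> 2 powr \<epsilon> * U (\<phi> \<zeta>)"
        using index[OF \<zeta>] by blast
      obtain c where c: "c \<in> K" "\<zeta> \<in> cball c (\<epsilon> / 8)" using K(2) \<zeta> by blast
      have "(1 + \<epsilon>) * h y * a j \<le> (1 + \<epsilon>) * h y * (2 powr \<epsilon> * U (\<phi> \<zeta>))"
        using j(3) eps h1[of y] y by (intro mult_left_mono) auto
      then have "b j \<le> u * h y * U (\<phi> \<zeta>)" by (simp add: b_def u_eq mult_ac)
      with j c show ?thesis by (intro bexI[of _ "(j, c)"]) (auto simp: I_def)
    qed
    have term_eq: "enn2ereal (ennreal u * C * ennreal (U (\<phi> \<zeta>))) = ereal (u * h y * U (\<phi> \<zeta>))" for \<zeta>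
      using u h1[of y] y U0 unfolding C by (simp add: ennreal_mult[symmetric] enn2ereal_ennreal)
    have I_ne: "I \<noteq> {}" using \<open>Z \<noteq> {}\<close> I_cover by auto
    have card_sum: "(\<Sum>(j, c)\<in>I. f j) = covering_number Z (\<epsilon> / 8) * (\<Sum>j = 0..J. f j)" for f :: "nat \<Rightarrow> ennreal"
      by (simp add: I_def K(3) sum.cartesian_product[symmetric] sum_distrib_left)

    \<comment> \<open>The probability bound\<close>
    have first: "ennreal (\<P>(\<omega> in M. Psi_star \<Psi> \<xi> U \<phi> Z u C \<omega> \<ge> 0))
        \<le> covering_number Z (\<epsilon> / 8) * (\<Sum>j = 0..J. L_series g \<epsilon> (slice \<phi> U Z (a j)) y)"
    proof -
      have "{\<omega> \<in> space M. Psi_star \<Psi> \<xi> U \<phi> Z u C \<omega> \<ge> 0}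
          \<subseteq> (\<Union>(j, c)\<in>I. {\<omega> \<in> space M. ennreal (b j) \<le> Y j c \<omega>})" (is "?P \<subseteq> ?Q")
      proof (rule ccontr)
        assume "\<not> ?P \<subseteq> ?Q"
        then obtain \<omega> where \<omega>: "\<omega> \<in> space M" "Psi_star \<Psi> \<xi> U \<phi> Z u C \<omega> \<ge> 0"
          and "\<omega> \<notin> ?Q" by auto
        then have lt: "Y j c \<omega> < ennreal (b j)" if "(j, c) \<in> I" for j c
          using that by (force simp: not_le[symmetric])
        \<comment> \<open>A supremum of negative terms may be 0. The maximum over the finite set
          \<open>I\<close> bounds all terms by one negative number.\<close>
        define m where "m = (MAX (j, c)\<in>I. enn2real (Y j c \<omega>) - b j)"
        have m_ge: "enn2real (Y j c \<omega>) - b j \<le> m" if "(j, c) \<in> I" for j c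
          unfolding m_def using I that by (intro Max_ge) force+
        have "m < 0"
        proof -
          have "enn2real (Y j c \<omega>) < b j" if "(j, c) \<in> I" for j c
            using lt[OF that] b_pos[of j] by (cases "Y j c \<omega>") (auto simp: ennreal_less_iff)
          then show ?thesis unfolding m_def using I I_ne by (subst Max_less_iff) auto
        qed
        have "Psi_star \<Psi> \<xi> U \<phi> Z u C \<omega> \<le> ereal m"
          unfolding Psi_star_def term_eq
        proof (rule SUP_least)
          fix \<zeta> assume "\<zeta> \<in> Z"
          then obtain j c where jc: "(j, c) \<in> I" "\<zeta> \<in> slice \<phi> U Z (a j) \<inter> cball c (\<epsilon> / 8)"
              "b j \<le> u * h y * U (\<phi> \<zeta>)" using I_cover by blast
          have "\<Psi> (\<xi> (\<phi> \<zeta>) \<omega>) \<le> enn2real (Y j c \<omega>)"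
            using Y_ge[OF jc(2) \<omega>(1)] lt[OF jc(1)] by (cases "Y j c \<omega>") auto
          with m_ge[OF jc(1)] jc(3)
          show "ereal (\<Psi> (\<xi> (\<phi> \<zeta>) \<omega>)) - ereal (u * h y * U (\<phi> \<zeta>)) \<le> ereal m" by simp
        qed
        also have "\<dots> < 0" using \<open>m < 0\<close> by simp
        finally show False using \<omega>(2) by simp
      qed
      then have "ennreal (measure M ?P) \<le> emeasure M ?Q"
        unfolding emeasure_eq_measure[symmetric] using I by (intro emeasure_mono) auto
      also have "\<dots> \<le> (\<Sum>(j, c)\<in>I. emeasure M {\<omega> \<in> space M. ennreal (b j) \<le> Y j c \<omega>})"
        unfolding case_prod_unfold using I by (intro emeasure_subadditive_finite) auto
      also have "\<dots> \<le> (\<Sum>(j, c)\<in>I. L_series g \<epsilon> (slice \<phi> U Z (a j)) y)"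
        unfolding b_def using Y_tail[OF y] by (intro sum_mono) auto
      finally show ?thesis unfolding card_sum .
    qed

    \<comment> \<open>The moment bound\<close>
    have second: "(\<integral>\<^sup>+\<omega>. ennreal_powr (e2ennreal (max 0 (Psi_star \<Psi> \<xi> U \<phi> Z u C \<omega>))) q \<partial>M)
           \<le> covering_number Z (\<epsilon> / 8) * ennreal_powr (ennreal u * C) q *
             (\<Sum>j = 0..J. ennreal (a j powr q) * J_integral g \<epsilon> q (slice \<phi> U Z (a j)) y)"
    proof -
      have pointwise: "ennreal_powr (e2ennreal (max 0 (Psi_star \<Psi> \<xi> U \<phi> Z u C \<omega>))) q
          \<le> (\<Sum>(j, c)\<in>I. ennreal_powr (Y j c \<omega> - ennreal (b j)) q)" if \<omega>: "\<omega> \<in> space M" for \<omega>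
      proof -
        \<comment> \<open>Subtraction in \<open>ennreal\<close> truncates at 0, so the positive part
          is built in. The maximum is attained, hence its power is one of the summands and no
          constant is lost.\<close>
        define G where "G = (MAX (j, c)\<in>I. Y j c \<omega> - ennreal (b j))"
        have G_ge: "Y j c \<omega> - ennreal (b j) \<le> G" if "(j, c) \<in> I" for j c
          unfolding G_def using I that by (intro Max_ge) force+
        have "G \<in> (\<lambda>(j, c). Y j c \<omega> - ennreal (b j)) ` I"
          unfolding G_def using I I_ne by (intro Max_in) auto
        then obtain j0 c0 where jc0: "(j0, c0) \<in> I" "G = Y j0 c0 \<omega> - ennreal (b j0)" by auto
        have "e2ennreal (max 0 (Psi_star \<Psi> \<xi> U \<phi> Z u C \<omega>)) \<le> G"
        proof (cases G)
          case (real m)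
          have "Psi_star \<Psi> \<xi> U \<phi> Z u C \<omega> \<le> ereal m"
            unfolding Psi_star_def term_eq
          proof (rule SUP_least)
            fix \<zeta> assume "\<zeta> \<in> Z"
            then obtain j c where jc: "(j, c) \<in> I" "\<zeta> \<in> slice \<phi> U Z (a j) \<inter> cball c (\<epsilon> / 8)"
                "b j \<le> u * h y * U (\<phi> \<zeta>)" using I_cover by blast
            have "ennreal (\<Psi> (\<xi> (\<phi> \<zeta>) \<omega>)) - ennreal (b j) \<le> ennreal m"
              using ennreal_minus_mono[OF Y_ge[OF jc(2) \<omega>] order_refl] G_ge[OF jc(1)] real
              by (metis order_trans)
            then have "\<Psi> (\<xi> (\<phi> \<zeta>) \<omega>) - b j \<le> m"
              using b_pos[of j] real by (simp add: ennreal_minus ennreal_le_iff less_imp_le)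
            with jc(3) show "ereal (\<Psi> (\<xi> (\<phi> \<zeta>) \<omega>)) - ereal (u * h y * U (\<phi> \<zeta>)) \<le> ereal m" by simp
          qed
          then have "e2ennreal (max 0 (Psi_star \<Psi> \<xi> U \<phi> Z u C \<omega>)) \<le> e2ennreal (ereal m)"
            using real by (intro e2ennreal_mono) simp
          then show ?thesis using real by (simp add: ennreal.rep_eq)
        qed simp
        then have "ennreal_powr (e2ennreal (max 0 (Psi_star \<Psi> \<xi> U \<phi> Z u C \<omega>))) q
            \<le> ennreal_powr (Y j0 c0 \<omega> - ennreal (b j0)) q"
          using q unfolding jc0(2) by (intro ennreal_powr_mono) auto
        also have "\<dots> \<le> (\<Sum>(j, c)\<in>I. ennreal_powr (Y j c \<omega> - ennreal (b j)) q)"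
          using member_le_sum[OF jc0(1), of "\<lambda>(j, c). ennreal_powr (Y j c \<omega> - ennreal (b j)) q"] I by simp
        finally show ?thesis .
      qed
      have moment: "(\<integral>\<^sup>+\<omega>. ennreal_powr (Y j c \<omega> - ennreal (b j)) q \<partial>M)
          \<le> ennreal (b j powr q) * J_integral g \<epsilon> q (slice \<phi> U Z (a j)) y" for j c
        unfolding J_integral_def
      proof (rule moment_le_tail_integral[OF Y_meas b_pos q])
        fix x :: real assume x: "1 < x"
        \<comment> \<open>This gives C*(x y) \<le> x C*(y), with \<open>h\<close> in the role of C*:
          the level \<open>b j * x\<close> exceeds the threshold belonging to
          \<open>y * x\<close>.\<close>
        have "sqrt x \<le> x" using x by (simp add: real_le_lsqrt real_sqrt_le_iff' power2_eq_square)
        then have "h (y * x) \<le> h y * x"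
          using x y ab0 mult_left_mono[of "sqrt x" x "sqrt y * \<alpha>"]
          by (simp add: h_def real_sqrt_mult algebra_simps)
        then have le: "(1 + \<epsilon>) * (a j * h (y * x)) \<le> b j * x"
          using eps a_pos[of j] mult_left_mono[of "h (y * x)" "h y * x" "(1 + \<epsilon>) * a j"]
          by (simp add: b_def mult_ac)
        have "emeasure M {\<omega> \<in> space M. ennreal (b j * x) \<le> Y j c \<omega>}
            \<le> emeasure M {\<omega> \<in> space M. ennreal ((1 + \<epsilon>) * (a j * h (y * x))) \<le> Y j c \<omega>}"
          using ennreal_leI[OF le] by (intro emeasure_mono) (auto intro: order_trans)
        also have "\<dots> \<le> L_series g \<epsilon> (slice \<phi> U Z (a j)) (y * x)"
          using x y by (intro Y_tail) simp
        finally show "emeasure M {\<omega> \<in> space M. ennreal (b j * x) \<le> Y j c \<omega>}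
            \<le> L_series g \<epsilon> (slice \<phi> U Z (a j)) (y * x)" .
      qed
      have b_powr: "ennreal (b j powr q) \<le> ennreal_powr (ennreal u * C) q * ennreal (a j powr q)" for j
      proof -
        have uh: "0 \<le> u * h y" using u h1[of y] y by simp
        \<comment> \<open>No comparison of \<open>a j\<close> with \<open>U\<close> occurs here, so
          1 + \<epsilon> \<le> u suffices.\<close>
        have "b j \<le> u * h y * a j"
          using u(2) a_pos[of j] h1[of y] y mult_right_mono[of "1 + \<epsilon>" u "a j * h y"] by (simp add: b_def mult_ac)
        then have "b j powr q \<le> (u * h y * a j) powr q" using b_pos[of j] q by (intro powr_mono2) auto
        also have "\<dots> = (u * h y) powr q * a j powr q"
          by (rule powr_mult)
        finally show ?thesis
          using u uh h1[of y] y unfolding C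
          by (simp add: ennreal_mult[symmetric] ennreal_powr_def ennreal_leI)
      qed
      have "(\<integral>\<^sup>+\<omega>. ennreal_powr (e2ennreal (max 0 (Psi_star \<Psi> \<xi> U \<phi> Z u C \<omega>))) q \<partial>M)
          \<le> (\<integral>\<^sup>+\<omega>. (\<Sum>(j, c)\<in>I. ennreal_powr (Y j c \<omega> - ennreal (b j)) q) \<partial>M)"
        by (rule nn_integral_mono) (rule pointwise)
      also have "\<dots> = (\<Sum>(j, c)\<in>I. \<integral>\<^sup>+\<omega>. ennreal_powr (Y j c \<omega> - ennreal (b j)) q \<partial>M)"
        unfolding case_prod_unfold by (intro nn_integral_sum) measurable
      also have "\<dots> \<le> (\<Sum>(j, c)\<in>I. ennreal (b j powr q) * J_integral g \<epsilon> q (slice \<phi> U Z (a j)) y)"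
        using moment by (intro sum_mono) auto
      also have "\<dots> \<le> (\<Sum>(j, c)\<in>I. ennreal_powr (ennreal u * C) q *
          (ennreal (a j powr q) * J_integral g \<epsilon> q (slice \<phi> U Z (a j)) y))"
        unfolding mult.assoc[symmetric] using b_powr by (intro sum_mono) (auto intro!: mult_right_mono)
      finally show ?thesis
        unfolding card_sum by (simp add: sum_distrib_left mult.assoc)
    qed
    from first second show ?thesis by blast
  qed
qed

end
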